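(* Let $\Lambda$ be a countable, finitely aligned left cancellative small category. Then the following statements are equivalent: (1) $\mathcal{G}_{tight}(\mathcal{S}_\Lambda)$ is minimal. (2) For every nonzero idempotents $e,f$ of $\mathcal{S}_\Lambda$ there are $s_1,\dots,s_n\in\mathcal{S}_\Lambda$ such that $\{s_ifs_i^*\}_{i=1}^n$ is an outer cover for $e$. (3) For every $\alpha,\beta\in\Lambda$ there exists $F\in\mathsf{FE}(\alpha)$ such that for each $\gamma\in F$, $s(\beta)\Lambda s(\gamma)\neq\emptyset$.
   Context: Categories. A small category $\Lambda$ is identified with its set of morphisms, objects $\Lambda^0$ with identity morphisms; $s(\alpha)$ is the domain and $r(\alpha)$ the range of $\alpha$; $\alpha\beta$ is defined when $s(\alpha)=r(\beta)$; $\alpha\Lambda=\{\alpha\beta: r(\beta)=s(\alpha)\}$, $v\Lambda w=\{\lambda:r(\lambda)=v,\ s(\lambda)=w\}$. $\Lambda$ is left cancellative if $\alpha\beta=\alpha\gamma$ implies $\beta=\gamma$; finitely aligned if for all $\alpha,\beta$ there is a finite $\Gamma\subset\Lambda$ with $\alpha\Lambda\cap\beta\Lambda=\bigcup_{\gamma\in\Gamma}\gamma\Lambda$. $\alpha\Cap\beta$ means $\alpha\Lambda\cap\beta\Lambda\neq\emptyset$. $\mathsf{FE}(\alpha)$ is the collection of finite $F\subset r(\alpha)\Lambda$ such that for every $\gamma\in\alpha\Lambda$ there is $\beta\in F$ with $\beta\Cap\gamma$. Inverse semigroup. $\tau^\alpha:s(\alpha)\Lambda\to\alpha\Lambda$,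 $\beta\mapsto\alpha\beta$, $\sigma^\alpha:=(\tau^\alpha)^{-1}$; $\mathcal{S}_\Lambda$ is the inverse semigroup of partial bijections of $\Lambda$ generated by all of these; $\mathcal{E}$ is its semilattice of idempotents ($e\le f$ iff $e=ef$); $0$ is the empty map. An outer cover for $e\in\mathcal{E}$ is a set $Z\subseteq\mathcal{E}$ such that for every nonzero $f\in\mathcal{E}$ with $f\le e$ there is $z\in Z$ with $zf\neq0$. Tight groupoid. A filter is a nonempty $\eta\subseteq\mathcal{E}$ not containing $0$, upward closed and closed under products; the set of filters has the topology with basis $\{\eta: X\subseteq\eta,\ Y\cap\eta=\emptyset\}$, $X,Y\subset\mathcal{E}$ finite; $\hat{\mathcal{E}}_{tight}$ is the closure of the set of ultrafilters (maximal filters). $s\in\mathcal{S}_\Lambda$ acts on $\eta\in\hat{\mathcal{E}}_{tight}$ with $s^*s\in\eta$ by $s\cdot\eta=\{f\in\mathcal{E}: ses^*\le f\text{ for some }e\in\eta\}$. $\mathcal{G}_{tight}(\mathcal{S}_\Lambda)$ is the étale groupoid of germs $[s,\eta]$ ($\eta\in\hat{\mathcal{E}}_{tight}$, $s^*s\in\eta$; $[s,\eta]=[t,\eta']$ iff $\eta=\eta'$ and $se=te$ for some $e\in\eta$), with unit space $\hat{\mathcal{E}}_{tight}$, $d[s,\eta]=\eta$, $r[s,\eta]=s\cdot\eta$, $[s,t\cdot\eta][t,\eta]=[st,\eta]$, and basic open sets $\{[s,\eta]:\eta\in U\}$, $U$ open in $\{\eta\in\hat{\mathcal{E}}_{tight}: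 s^*s\in\eta\}$. An étale groupoid is minimal if its unit space has no open invariant subsets other than the empty set and the whole space. *)

theory Defs
  imports "HOL-Analysis.Analysis"
begin

section \<open>Small categories\<close>

text \<open>A small category is identified with its set of morphisms; an object is identified with its
  identity morphism. The product \<open>cmp \<Lambda> \<alpha> \<beta>\<close> is meaningful when \<open>src \<Lambda> \<alpha> = rng \<Lambda> \<beta>\<close>.\<close>

record 'a category =
  mor :: "'a set"
  src :: "'a \<Rightarrow> 'a"
  rng :: "'a \<Rightarrow> 'a"
  cmp :: "'a \<Rightarrow> 'a \<Rightarrow> 'a"

locale small_category =
  fixes \<Lambda> :: "'a category"
  assumes src_mor: "\<alpha> \<in> mor \<Lambda> \<Longrightarrow> src \<Lambda> \<alpha> \<in> mor \<Lambda>"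
    and rng_mor: "\<alpha> \<in> mor \<Lambda> \<Longrightarrow> rng \<Lambda> \<alpha> \<in> mor \<Lambda>"
    and src_src: "\<alpha> \<in> mor \<Lambda> \<Longrightarrow> src \<Lambda> (src \<Lambda> \<alpha>) = src \<Lambda> \<alpha>"
    and rng_src: "\<alpha> \<in> mor \<Lambda> \<Longrightarrow> rng \<Lambda> (src \<Lambda> \<alpha>) = src \<Lambda> \<alpha>"
    and src_rng: "\<alpha> \<in> mor \<Lambda> \<Longrightarrow> src \<Lambda> (rng \<Lambda> \<alpha>) = rng \<Lambda> \<alpha>"
    and rng_rng: "\<alpha> \<in> mor \<Lambda> \<Longrightarrow> rng \<Lambda> (rng \<Lambda> \<alpha>) = rng \<Lambda> \<alpha>"
    and cmp_mor: "\<lbrakk>\<alpha> \<in> mor \<Lambda>; \<beta> \<in> mor \<Lambda>; src \<Lambda> \<alpha> = rng \<Lambda> \<beta>\<rbrakk> \<Longrightarrow> cmp \<Lambda> \<alpha> \<beta> \<in> mor \<Lambda>"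
    and src_cmp: "\<lbrakk>\<alpha> \<in> mor \<Lambda>; \<beta> \<in> mor \<Lambda>; src \<Lambda> \<alpha> = rng \<Lambda> \<beta>\<rbrakk> \<Longrightarrow> src \<Lambda> (cmp \<Lambda> \<alpha> \<beta>) = src \<Lambda> \<beta>"
    and rng_cmp: "\<lbrakk>\<alpha> \<in> mor \<Lambda>; \<beta> \<in> mor \<Lambda>; src \<Lambda> \<alpha> = rng \<Lambda> \<beta>\<rbrakk> \<Longrightarrow> rng \<Lambda> (cmp \<Lambda> \<alpha> \<beta>) = rng \<Lambda> \<alpha>"
    and cmp_assoc: "\<lbrakk>\<alpha> \<in> mor \<Lambda>; \<beta> \<in> mor \<Lambda>; \<gamma> \<in> mor \<Lambda>; src \<Lambda> \<alpha> = rng \<Lambda> \<beta>; src \<Lambda> \<beta> = rng \<Lambda> \<gamma>\<rbrakk>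
      \<Longrightarrow> cmp \<Lambda> (cmp \<Lambda> \<alpha> \<beta>) \<gamma> = cmp \<Lambda> \<alpha> (cmp \<Lambda> \<beta> \<gamma>)"
    and cmp_rng: "\<alpha> \<in> mor \<Lambda> \<Longrightarrow> cmp \<Lambda> (rng \<Lambda> \<alpha>) \<alpha> = \<alpha>"
    and cmp_src: "\<alpha> \<in> mor \<Lambda> \<Longrightarrow> cmp \<Lambda> \<alpha> (src \<Lambda> \<alpha>) = \<alpha>"

definition left_cancellative :: "'a category \<Rightarrow> bool" where
  "left_cancellative \<Lambda> \<longleftrightarrow>
    (\<forall>\<alpha>\<in>mor \<Lambda>. \<forall>\<beta>\<in>mor \<Lambda>. \<forall>\<gamma>\<in>mor \<Lambda>. src \<Lambda> \<alpha> = rng \<Lambda> \<beta> \<longrightarrow> src \<Lambda> \<alpha> = rng \<Lambda> \<gamma> \<longrightarrow>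
       cmp \<Lambda> \<alpha> \<beta> = cmp \<Lambda> \<alpha> \<gamma> \<longrightarrow> \<beta> = \<gamma>)"

text \<open>\<open>right_ideal \<Lambda> \<alpha>\<close> is \<open>\<alpha>\<Lambda>\<close>; for an object \<open>v\<close> it is the set of morphisms with range \<open>v\<close>.\<close>

definition right_ideal :: "'a category \<Rightarrow> 'a \<Rightarrow> 'a set" where
  "right_ideal \<Lambda> \<alpha> = {cmp \<Lambda> \<alpha> \<beta> | \<beta>. \<beta> \<in> mor \<Lambda> \<and> rng \<Lambda> \<beta> = src \<Lambda> \<alpha>}"

definition homset :: "'a category \<Rightarrow> 'a \<Rightarrow> 'a \<Rightarrow> 'a set" where
  "homset \<Lambda> v w = {\<gamma> \<in> mor \<Lambda>. rng \<Lambda> \<gamma> = v \<and> src \<Lambda> \<gamma> = w}"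

definition finitely_aligned :: "'a category \<Rightarrow> bool" where
  "finitely_aligned \<Lambda> \<longleftrightarrow>
    (\<forall>\<alpha>\<in>mor \<Lambda>. \<forall>\<beta>\<in>mor \<Lambda>. \<exists>\<Gamma>\<subseteq>mor \<Lambda>. finite \<Gamma> \<and>
       right_ideal \<Lambda> \<alpha> \<inter> right_ideal \<Lambda> \<beta> = (\<Union>\<gamma>\<in>\<Gamma>. right_ideal \<Lambda> \<gamma>))"

definition meets :: "'a category \<Rightarrow> 'a \<Rightarrow> 'a \<Rightarrow> bool" where
  "meets \<Lambda> \<alpha> \<beta> \<longleftrightarrow> right_ideal \<Lambda> \<alpha> \<inter> right_ideal \<Lambda> \<beta> \<noteq> {}"

definition FE :: "'a category \<Rightarrow> 'a \<Rightarrow> 'a set set" where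
  "FE \<Lambda> \<alpha> = {F. finite F \<and> F \<subseteq> right_ideal \<Lambda> (rng \<Lambda> \<alpha>) \<and>
     (\<forall>\<gamma>\<in>right_ideal \<Lambda> \<alpha>. \<exists>\<beta>\<in>F. meets \<Lambda> \<beta> \<gamma>)}"


section \<open>The inverse semigroup of a category\<close>

text \<open>A partial map is represented by its graph, so that the inverse \<open>s\<^sup>*\<close> is \<open>s\<inverse>\<close>, the empty map
  is \<open>{}\<close>, and \<open>s \<odot> t\<close> means: first apply \<open>t\<close>, then \<open>s\<close>.
  The generated semigroup need not contain the empty map (for instance if \<open>\<Lambda>\<close> is a group); no zero is
  adjoined, since filters, germs and outer covers only involve nonzero idempotents.\<close>

type_synonym 'a pmap = "('a \<times> 'a) set"

abbreviation pmult :: "'a pmap \<Rightarrow> 'a pmap \<Rightarrow> 'a pmap" (infixl "\<odot>" 75) where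
  "s \<odot> t \<equiv> t O s"

definition tau :: "'a category \<Rightarrow> 'a \<Rightarrow> 'a pmap" where
  "tau \<Lambda> \<alpha> = {(\<beta>, cmp \<Lambda> \<alpha> \<beta>) | \<beta>. \<beta> \<in> right_ideal \<Lambda> (src \<Lambda> \<alpha>)}"

definition sigma :: "'a category \<Rightarrow> 'a \<Rightarrow> 'a pmap" where
  "sigma \<Lambda> \<alpha> = (tau \<Lambda> \<alpha>)\<inverse>"

inductive_set cat_semigroup :: "'a category \<Rightarrow> 'a pmap set" for \<Lambda> where
  tau: "\<alpha> \<in> mor \<Lambda> \<Longrightarrow> tau \<Lambda> \<alpha> \<in> cat_semigroup \<Lambda>"
| sigma: "\<alpha> \<in> mor \<Lambda> \<Longrightarrow> sigma \<Lambda> \<alpha> \<in> cat_semigroup \<Lambda>"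
| star: "s \<in> cat_semigroup \<Lambda> \<Longrightarrow> s\<inverse> \<in> cat_semigroup \<Lambda>"
| mult: "s \<in> cat_semigroup \<Lambda> \<Longrightarrow> t \<in> cat_semigroup \<Lambda> \<Longrightarrow> s \<odot> t \<in> cat_semigroup \<Lambda>"


section \<open>Inverse semigroups of partial bijections and their tight groupoids\<close>

definition idems :: "'a pmap set \<Rightarrow> 'a pmap set" where
  "idems S = {e \<in> S. e \<odot> e = e}"

definition idem_le :: "'a pmap \<Rightarrow> 'a pmap \<Rightarrow> bool" where
  "idem_le e f \<longleftrightarrow> e = e \<odot> f"

definition outer_cover :: "'a pmap set \<Rightarrow> 'a pmap \<Rightarrow> 'a pmap set \<Rightarrow> bool" where
  "outer_cover S e Z \<longleftrightarrow> Z \<subseteq> idems S \<and>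
    (\<forall>f\<in>idems S. f \<noteq> {} \<and> idem_le f e \<longrightarrow> (\<exists>z\<in>Z. z \<odot> f \<noteq> {}))"

definition filters :: "'a pmap set \<Rightarrow> 'a pmap set set" where
  "filters S = {\<eta>. \<eta> \<subseteq> idems S \<and> \<eta> \<noteq> {} \<and> {} \<notin> \<eta> \<and>
     (\<forall>e\<in>\<eta>. \<forall>f\<in>idems S. idem_le e f \<longrightarrow> f \<in> \<eta>) \<and>
     (\<forall>e\<in>\<eta>. \<forall>f\<in>\<eta>. e \<odot> f \<in> \<eta>)}"

definition ultrafilters :: "'a pmap set \<Rightarrow> 'a pmap set set" where
  "ultrafilters S = {\<eta> \<in> filters S. \<forall>\<xi>\<in>filters S. \<eta> \<subseteq> \<xi> \<longrightarrow> \<xi> = \<eta>}"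

text \<open>The generating sets below are closed under finite intersections and contain the whole space,
  so they are a basis of the topology they generate.\<close>

definition filter_topology :: "'a pmap set \<Rightarrow> 'a pmap set topology" where
  "filter_topology S = topology_generated_by
     {{\<eta> \<in> filters S. X \<subseteq> \<eta> \<and> Y \<inter> \<eta> = {}} | X Y.
        finite X \<and> X \<subseteq> idems S \<and> finite Y \<and> Y \<subseteq> idems S}"

definition tight_filters :: "'a pmap set \<Rightarrow> 'a pmap set set" where
  "tight_filters S = filter_topology S closure_of ultrafilters S"

definition tight_topology :: "'a pmap set \<Rightarrow> 'a pmap set topology" where
  "tight_topology S = subtopology (filter_topology S) (tight_filters S)"

definition act :: "'a pmap set \<Rightarrow> 'a pmap \<Rightarrow> 'a pmap set \<Rightarrow> 'a pmap set" where
  "act S s \<eta> = {f \<in> idems S. \<exists>e\<in>\<eta>. idem_le (s \<odot> e \<odot> s\<inverse>) f}"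

definition act_dom :: "'a pmap set \<Rightarrow> 'a pmap \<Rightarrow> 'a pmap set set" where
  "act_dom S s = {\<eta> \<in> tight_filters S. s\<inverse> \<odot> s \<in> \<eta>}"

definition germ_pairs :: "'a pmap set \<Rightarrow> ('a pmap \<times> 'a pmap set) set" where
  "germ_pairs S = {(s, \<eta>). s \<in> S \<and> \<eta> \<in> act_dom S s}"

definition germ_rel ::
    "'a pmap set \<Rightarrow> (('a pmap \<times> 'a pmap set) \<times> ('a pmap \<times> 'a pmap set)) set" where
  "germ_rel S = {((s, \<eta>), (t, \<eta>')). (s, \<eta>) \<in> germ_pairs S \<and> (t, \<eta>') \<in> germ_pairs S \<and>
     \<eta> = \<eta>' \<and> (\<exists>e\<in>\<eta>. s \<odot> e = t \<odot> e)}"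

type_synonym 'a germ = "('a pmap \<times> 'a pmap set) set"

definition germ :: "'a pmap set \<Rightarrow> 'a pmap \<Rightarrow> 'a pmap set \<Rightarrow> 'a germ" where
  "germ S s \<eta> = germ_rel S `` {(s, \<eta>)}"

text \<open>A topological groupoid is given by its unit space, its space of arrows, the domain and range
  maps into the unit space, and its multiplication.\<close>

record ('u, 'g) groupoid =
  unit_space :: "'u topology"
  arrow_space :: "'g topology"
  dmap :: "'g \<Rightarrow> 'u"
  rmap :: "'g \<Rightarrow> 'u"
  gmult :: "'g \<Rightarrow> 'g \<Rightarrow> 'g"

definition invariant_set :: "('u, 'g) groupoid \<Rightarrow> 'u set \<Rightarrow> bool" where
  "invariant_set G U \<longleftrightarrow> U \<subseteq> topspace (unit_space G) \<and>
     (\<forall>g\<in>topspace (arrow_space G). dmap G g \<in> U \<longrightarrow> rmap G g \<in> U)"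

definition minimal_groupoid :: "('u, 'g) groupoid \<Rightarrow> bool" where
  "minimal_groupoid G \<longleftrightarrow>
     (\<forall>U. openin (unit_space G) U \<and> invariant_set G U \<longrightarrow> U = {} \<or> U = topspace (unit_space G))"

text \<open>The unit space is the space of tight filters itself, a filter \<open>\<eta>\<close> corresponding to the arrow
  \<open>germ S e \<eta>\<close> for any \<open>e \<in> \<eta>\<close>. The sets generating the arrow topology form a basis: two germs agree on
  an open set of filters. The structure maps are defined on germs through arbitrary representatives; that they are well
  defined is shown by \<open>dmap_germ\<close>, \<open>rmap_germ\<close> and \<open>gmult_germ\<close> below.\<close>

definition tight_groupoid :: "'a pmap set \<Rightarrow> ('a pmap set, 'a germ) groupoid" where
  "tight_groupoid S =
     \<lparr> unit_space = tight_topology S,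
       arrow_space = topology_generated_by
         {germ S s ` U | s U. s \<in> S \<and> openin (subtopology (tight_topology S) (act_dom S s)) U},
       dmap = (\<lambda>g. the_elem (snd ` g)),
       rmap = (\<lambda>g. the_elem ((\<lambda>(s, \<eta>). act S s \<eta>) ` g)),
       gmult = (\<lambda>g h. germ_rel S `` {(s \<odot> t, \<eta>) | s t \<eta>. (s, act S t \<eta>) \<in> g \<and> (t, \<eta>) \<in> h}) \<rparr>"


section \<open>Well-definedness of the tight groupoid\<close>

locale pbij_semigroup =
  fixes S :: "'a pmap set"
  assumes sv: "s \<in> S \<Longrightarrow> single_valued s"
    and mult_closed: "s \<in> S \<Longrightarrow> t \<in> S \<Longrightarrow> s \<odot> t \<in> S"
    and star_closed: "s \<in> S \<Longrightarrow> s\<inverse> \<in> S"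
begin

lemma idem_Id: "e \<in> idems S \<Longrightarrow> e \<subseteq> Id"
proof
  fix p assume e: "e \<in> idems S" and p: "p \<in> e"
  obtain x y where xy: "p = (x, y)" by fastforce
  have eq: "e O e = e" and sve: "single_valued e" and svc: "single_valued (e\<inverse>)"
    using e sv star_closed unfolding idems_def by auto
  obtain z where "(x, z) \<in> e" "(z, y) \<in> e" using eq p xy by blast
  then have "(y, y) \<in> e" using sve p xy by (metis single_valuedD)
  then have "x = y" using svc p xy by (meson converse_iff single_valuedD)
  then show "p \<in> Id" using xy by simp
qed

lemma idem_le_iff:
  assumes "e \<subseteq> Id" "f \<subseteq> Id" shows "idem_le e f \<longleftrightarrow> e \<subseteq> f"
proof -
  have "e \<odot> f = e \<inter> f" using assms by auto
  then show ?thesis unfolding idem_le_def by auto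
qed

lemma conj_Id: "s \<in> S \<Longrightarrow> e \<subseteq> Id \<Longrightarrow> s \<odot> e \<odot> s\<inverse> \<subseteq> Id"
  using single_valuedD[OF sv] by auto

lemma filter_Id: "\<eta> \<in> filters S \<Longrightarrow> e \<in> \<eta> \<Longrightarrow> e \<subseteq> Id"
  by (rule idem_Id) (auto simp: filters_def)

lemma filter_mult: "\<eta> \<in> filters S \<Longrightarrow> e \<in> \<eta> \<Longrightarrow> f \<in> \<eta> \<Longrightarrow> e \<odot> f \<in> \<eta>"
  by (simp add: filters_def)

lemma tight_filter: "\<eta> \<in> tight_filters S \<Longrightarrow> \<eta> \<in> filters S"
  unfolding tight_filters_def closure_of_def filter_topology_def topology_generated_by_topspace
  by auto

lemma germ_pairsD:
  assumes "(s, \<eta>) \<in> germ_pairs S"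
  shows "s \<in> S" "\<eta> \<in> filters S" "\<eta> \<in> tight_filters S" "s\<inverse> \<odot> s \<in> \<eta>"
  using assms tight_filter unfolding germ_pairs_def act_dom_def by auto

lemma act_iff:
  assumes "s \<in> S" "\<eta> \<in> filters S"
  shows "f \<in> act S s \<eta> \<longleftrightarrow> f \<in> idems S \<and> (\<exists>e\<in>\<eta>. s \<odot> e \<odot> s\<inverse> \<subseteq> f)"
proof -
  have "idem_le (s \<odot> e \<odot> s\<inverse>) f \<longleftrightarrow> s \<odot> e \<odot> s\<inverse> \<subseteq> f" if "f \<in> idems S" "e \<in> \<eta>" for e
    using idem_le_iff[OF conj_Id[OF assms(1) filter_Id[OF assms(2) that(2)]] idem_Id[OF that(1)]] .
  then show ?thesis unfolding act_def by blast
qed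

lemma equiv_germ_rel: "equiv (germ_pairs S) (germ_rel S)"
proof (rule equivI)
  show "germ_rel S \<subseteq> germ_pairs S \<times> germ_pairs S" unfolding germ_rel_def by auto
  show "refl_on (germ_pairs S) (germ_rel S)"
  proof (rule refl_onI, clarify)
    fix s \<eta> assume h: "(s, \<eta>) \<in> germ_pairs S"
    then have "\<exists>e\<in>\<eta>. s \<odot> e = s \<odot> e" using germ_pairsD(4) by blast
    then show "((s, \<eta>), (s, \<eta>)) \<in> germ_rel S" using h unfolding germ_rel_def by simp
  qed
  show "sym (germ_rel S)"
  proof (rule symI, clarify)
    fix s \<eta> t \<eta>' assume "((s, \<eta>), (t, \<eta>')) \<in> germ_rel S"
    then have h: "(s, \<eta>) \<in> germ_pairs S" "(t, \<eta>') \<in> germ_pairs S" "\<eta> = \<eta>'"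
      "\<exists>e\<in>\<eta>. s \<odot> e = t \<odot> e" unfolding germ_rel_def by blast+
    from h(4) obtain e where "e \<in> \<eta>" "s \<odot> e = t \<odot> e" by blast
    then have "\<exists>e\<in>\<eta>. t \<odot> e = s \<odot> e" by (metis (no_types))
    then show "((t, \<eta>'), (s, \<eta>)) \<in> germ_rel S" using h(1-3) unfolding germ_rel_def by simp
  qed
  show "trans (germ_rel S)"
  proof (rule transI, clarify)
    fix s \<eta> t \<eta>' u \<eta>''
    assume 1: "((s, \<eta>), (t, \<eta>')) \<in> germ_rel S" and 2: "((t, \<eta>'), (u, \<eta>'')) \<in> germ_rel S"
    then have eqs: "\<eta>' = \<eta>" "\<eta>'' = \<eta>" unfolding germ_rel_def by auto
    from 1 obtain e where e: "e \<in> \<eta>" "s \<odot> e = t \<odot> e" unfolding germ_rel_def by auto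
    from 2 obtain f where f: "f \<in> \<eta>" "t \<odot> f = u \<odot> f" unfolding germ_rel_def eqs by auto
    have \<eta>: "\<eta> \<in> filters S" using 1 germ_pairsD unfolding germ_rel_def by auto
    have comm: "e \<odot> f = f \<odot> e" using filter_Id[OF \<eta>] e f by blast
    have "s \<odot> (e \<odot> f) = t \<odot> (e \<odot> f)" using e(2) by (metis O_assoc)
    also have "\<dots> = u \<odot> (e \<odot> f)" using f(2) comm by (metis O_assoc)
    finally have "\<exists>e\<in>\<eta>. s \<odot> e = u \<odot> e" using filter_mult[OF \<eta> e(1) f(1)] by blast
    moreover have "(s, \<eta>) \<in> germ_pairs S" "(u, \<eta>) \<in> germ_pairs S"
      using 1 2 unfolding germ_rel_def eqs by blast+
    ultimately show "((s, \<eta>), (u, \<eta>'')) \<in> germ_rel S" unfolding germ_rel_def eqs by blast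
  qed
qed

lemma germ_mem: "(t, \<eta>') \<in> germ S s \<eta> \<longleftrightarrow> ((s, \<eta>), (t, \<eta>')) \<in> germ_rel S"
  unfolding germ_def by simp

lemma germ_self: "(s, \<eta>) \<in> germ_pairs S \<Longrightarrow> (s, \<eta>) \<in> germ S s \<eta>"
  unfolding germ_mem using equiv_germ_rel by (metis equivE refl_onD)

lemma germ_eq_iff:
  assumes "(s, \<eta>) \<in> germ_pairs S" "(t, \<eta>') \<in> germ_pairs S"
  shows "germ S s \<eta> = germ S t \<eta>' \<longleftrightarrow> \<eta> = \<eta>' \<and> (\<exists>e\<in>\<eta>. s \<odot> e = t \<odot> e)"
proof -
  have "((s, \<eta>), (t, \<eta>')) \<in> germ_rel S \<longleftrightarrow> \<eta> = \<eta>' \<and> (\<exists>e\<in>\<eta>. s \<odot> e = t \<odot> e)"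
    using assms unfolding germ_rel_def mem_Collect_eq prod.case by (simp (no_asm_simp))
  then show ?thesis unfolding germ_def eq_equiv_class_iff[OF equiv_germ_rel assms] .
qed

lemma act_cong:
  assumes "((s, \<eta>), (t, \<eta>)) \<in> germ_rel S" shows "act S s \<eta> \<subseteq> act S t \<eta>"
proof
  from assms obtain e where e: "e \<in> \<eta>" "s \<odot> e = t \<odot> e" unfolding germ_rel_def by auto
  have st: "s \<in> S" "t \<in> S" "\<eta> \<in> filters S"
    using assms germ_pairsD unfolding germ_rel_def by auto
  fix f assume "f \<in> act S s \<eta>"
  then obtain g where g: "f \<in> idems S" "g \<in> \<eta>" "s \<odot> g \<odot> s\<inverse> \<subseteq> f"
    using act_iff[OF st(1,3)] by auto
  have Id: "e \<subseteq> Id" "g \<subseteq> Id" using filter_Id[OF st(3)] e g by auto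
  have "t \<odot> (e \<odot> g) \<odot> t\<inverse> \<subseteq> s \<odot> g \<odot> s\<inverse>"
  proof
    fix p assume "p \<in> t \<odot> (e \<odot> g) \<odot> t\<inverse>"
    then obtain a b c d k where p: "p = (a, d)"
      and h: "(b, a) \<in> t" "(b, k) \<in> g" "(k, c) \<in> e" "(c, d) \<in> t" by blast
    then have [simp]: "k = b" "c = b" using Id by auto
    have "(b, a) \<in> e O s" "(b, d) \<in> e O s" using h e(2) by auto
    then have "(b, a) \<in> s" "(b, d) \<in> s" using Id by auto
    then show "p \<in> s \<odot> g \<odot> s\<inverse>" using h p by auto
  qed
  then show "f \<in> act S t \<eta>"
    using act_iff[OF st(2,3)] g filter_mult[OF st(3) e(1) g(2)] by blast
qed

lemma act_cong_eq:
  assumes "((s, \<eta>), (t, \<eta>')) \<in> germ_rel S" shows "act S s \<eta> = act S t \<eta>'" "\<eta>' = \<eta>"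
proof -
  show "\<eta>' = \<eta>" using assms unfolding germ_rel_def by auto
  moreover have "((t, \<eta>'), (s, \<eta>)) \<in> germ_rel S" using assms equiv_germ_rel by (meson equivE symD)
  ultimately show "act S s \<eta> = act S t \<eta>'" using act_cong assms by blast
qed

lemma dmap_germ:
  assumes "(s, \<eta>) \<in> germ_pairs S" shows "dmap (tight_groupoid S) (germ S s \<eta>) = \<eta>"
proof -
  have "snd ` germ S s \<eta> = {\<eta>}"
  proof (intro equalityI subsetI)
    fix x assume "x \<in> snd ` germ S s \<eta>"
    then show "x \<in> {\<eta>}" using act_cong_eq(2) by (fastforce simp: germ_mem)
  qed (use germ_self[OF assms] in \<open>auto intro: rev_image_eqI\<close>)
  then show ?thesis unfolding tight_groupoid_def by simp
qed

lemma rmap_germ: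
  assumes "(s, \<eta>) \<in> germ_pairs S" shows "rmap (tight_groupoid S) (germ S s \<eta>) = act S s \<eta>"
proof -
  have "(\<lambda>(s, \<eta>). act S s \<eta>) ` germ S s \<eta> = {act S s \<eta>}"
  proof (intro equalityI subsetI)
    fix x assume "x \<in> (\<lambda>(s, \<eta>). act S s \<eta>) ` germ S s \<eta>"
    then obtain t \<eta>' where "x = act S t \<eta>'" "((s, \<eta>), (t, \<eta>')) \<in> germ_rel S"
      unfolding image_iff by (auto simp: germ_mem)
    then show "x \<in> {act S s \<eta>}" using act_cong_eq(1) by blast
  qed (use germ_self[OF assms] in \<open>auto intro: rev_image_eqI\<close>)
  then show ?thesis unfolding tight_groupoid_def by simp
qed

lemma gmult_pairs:
  assumes "(s, act S t \<eta>) \<in> germ_pairs S" "(t, \<eta>) \<in> germ_pairs S"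
  shows "(s \<odot> t, \<eta>) \<in> germ_pairs S"
proof -
  note s = germ_pairsD[OF assms(1)] and t = germ_pairsD[OF assms(2)]
  obtain e where e: "e \<in> \<eta>" "t \<odot> e \<odot> t\<inverse> \<subseteq> s\<inverse> \<odot> s"
    using s(4) act_iff[OF t(1,2)] by auto
  have eId: "e \<subseteq> Id" using filter_Id[OF t(2) e(1)] .
  have st: "s \<odot> t \<in> S" using mult_closed s(1) t(1) .
  have dId: "(s \<odot> t)\<inverse> \<odot> (s \<odot> t) \<subseteq> Id"
    using sv[OF star_closed[OF st]] unfolding single_valued_def by blast
  then have dE: "(s \<odot> t)\<inverse> \<odot> (s \<odot> t) \<in> idems S"
    unfolding idems_def using mult_closed[OF star_closed[OF st] st] by blast
  let ?g = "(t\<inverse> \<odot> t) \<odot> e"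
  have g: "?g \<in> \<eta>" using filter_mult[OF t(2) t(4) e(1)] .
  have "?g \<subseteq> (s \<odot> t)\<inverse> \<odot> (s \<odot> t)"
  proof
    fix p assume "p \<in> ?g"
    then obtain x y z w where p: "p = (x, w)"
      and h: "(x, y) \<in> e" "(y, z) \<in> t" "(w, z) \<in> t" by blast
    then have [simp]: "y = x" using eId by auto
    have "w = y" using h sv[OF star_closed[OF t(1)]] unfolding single_valued_def by blast
    then have [simp]: "w = x" by simp
    have "(z, z) \<in> t \<odot> e \<odot> t\<inverse>" using h by auto
    then have "(z, z) \<in> s\<inverse> \<odot> s" using e(2) by blast
    then obtain q where "(z, q) \<in> s" by blast
    then show "p \<in> (s \<odot> t)\<inverse> \<odot> (s \<odot> t)" using h p by auto
  qed
  then have "idem_le ?g ((s \<odot> t)\<inverse> \<odot> (s \<odot> t))"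
    using idem_le_iff[OF filter_Id[OF t(2) g] dId] by blast
  then have "(s \<odot> t)\<inverse> \<odot> (s \<odot> t) \<in> \<eta>" using t(2) g dE unfolding filters_def by blast
  then show ?thesis using st t unfolding germ_pairs_def act_dom_def by auto
qed

lemma gmult_germ:
  assumes "(s, act S t \<eta>) \<in> germ_pairs S" "(t, \<eta>) \<in> germ_pairs S"
  shows "gmult (tight_groupoid S) (germ S s (act S t \<eta>)) (germ S t \<eta>) = germ S (s \<odot> t) \<eta>"
proof -
  let ?A = "{(u \<odot> v, \<zeta>) | u v \<zeta>. (u, act S v \<zeta>) \<in> germ S s (act S t \<eta>) \<and> (v, \<zeta>) \<in> germ S t \<eta>}"
  have self: "(s \<odot> t, \<eta>) \<in> ?A" using germ_self[OF assms(1)] germ_self[OF assms(2)] by blast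
  have sub: "germ_rel S `` {p} = germ S (s \<odot> t) \<eta>" if p: "p \<in> ?A" for p
  proof -
    from p obtain u v \<zeta> where p_eq: "p = (u \<odot> v, \<zeta>)"
      and "((s, act S t \<eta>), (u, act S v \<zeta>)) \<in> germ_rel S"
      and v: "((t, \<eta>), (v, \<zeta>)) \<in> germ_rel S" unfolding germ_mem by blast
    moreover have \<zeta>: "\<zeta> = \<eta>" "act S v \<zeta> = act S t \<eta>" using act_cong_eq[OF v] by auto
    ultimately have u: "((s, act S t \<eta>), (u, act S t \<eta>)) \<in> germ_rel S" by simp
    have up: "(u, act S v \<eta>) \<in> germ_pairs S" "(v, \<eta>) \<in> germ_pairs S"
      using u v \<zeta> unfolding germ_rel_def by auto
    note t = germ_pairsD[OF assms(2)]
    obtain e where e: "e \<in> act S t \<eta>" "s \<odot> e = u \<odot> e" using u unfolding germ_rel_def by auto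
    obtain f where f: "f \<in> \<eta>" "t \<odot> f = v \<odot> f" using v unfolding germ_rel_def by auto
    obtain g where g: "g \<in> \<eta>" "t \<odot> g \<odot> t\<inverse> \<subseteq> e" using e(1) act_iff[OF t(1,2)] by auto
    have Id: "f \<subseteq> Id" "g \<subseteq> Id" "e \<subseteq> Id"
      using filter_Id[OF t(2)] f g filter_Id[OF germ_pairsD(2)[OF assms(1)] e(1)] by auto
    have "t \<odot> g = e \<odot> (t \<odot> g)"
    proof
      show "e \<odot> (t \<odot> g) \<subseteq> t \<odot> g" using Id by blast
      show "t \<odot> g \<subseteq> e \<odot> (t \<odot> g)"
      proof clarify
        fix x y z assume h: "(x, y) \<in> g" "(y, z) \<in> t"
        moreover have "y = x" using h Id by auto
        ultimately have "(z, z) \<in> t \<odot> g \<odot> t\<inverse>" by auto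
        then show "(x, z) \<in> e \<odot> (t \<odot> g)" using g(2) h by blast
      qed
    qed
    then have 1: "s \<odot> (t \<odot> g) = u \<odot> (t \<odot> g)" using e(2) by (metis O_assoc)
    have comm: "g \<odot> f = f \<odot> g" using Id by blast
    have "(s \<odot> t) \<odot> (g \<odot> f) = (u \<odot> t) \<odot> (g \<odot> f)" using 1 by (metis O_assoc)
    also have "\<dots> = (u \<odot> v) \<odot> (g \<odot> f)" unfolding comm using f(2) by (metis O_assoc)
    finally have "(s \<odot> t) \<odot> (g \<odot> f) = (u \<odot> v) \<odot> (g \<odot> f)" .
    then have "germ S (s \<odot> t) \<eta> = germ S (u \<odot> v) \<eta>"
      using germ_eq_iff[OF gmult_pairs[OF assms] gmult_pairs[OF up]] filter_mult[OF t(2) g(1) f(1)]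
      by blast
    then show ?thesis unfolding p_eq \<zeta>(1) germ_def by simp
  qed
  have "germ_rel S `` ?A = (\<Union>p\<in>?A. germ_rel S `` {p})" by (rule Image_eq_UN)
  also have "\<dots> = germ S (s \<odot> t) \<eta>" using sub self by blast
  finally show ?thesis unfolding tight_groupoid_def by simp
qed

end

lemma pbij_cat_semigroup:
  assumes "small_category \<Lambda>" "left_cancellative \<Lambda>"
  shows "pbij_semigroup (cat_semigroup \<Lambda>)"
proof
  interpret small_category \<Lambda> by (rule assms(1))
  have ri: "\<beta> \<in> mor \<Lambda> \<and> rng \<Lambda> \<beta> = src \<Lambda> \<alpha>"
    if a: "\<alpha> \<in> mor \<Lambda>" and b: "\<beta> \<in> right_ideal \<Lambda> (src \<Lambda> \<alpha>)" for \<alpha> \<beta>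
  proof -
    obtain \<delta> where d: "\<beta> = cmp \<Lambda> (src \<Lambda> \<alpha>) \<delta>" "\<delta> \<in> mor \<Lambda>" "rng \<Lambda> \<delta> = src \<Lambda> (src \<Lambda> \<alpha>)"
      using b unfolding right_ideal_def by blast
    have r: "rng \<Lambda> \<delta> = src \<Lambda> \<alpha>" unfolding d(3) by (rule src_src[OF a])
    have "\<beta> = \<delta>" unfolding d(1) r[symmetric] by (rule cmp_rng[OF d(2)])
    then show ?thesis using d(2) r by blast
  qed
  have gen: "single_valued (tau \<Lambda> \<alpha>)" "single_valued ((tau \<Lambda> \<alpha>)\<inverse>)" if "\<alpha> \<in> mor \<Lambda>" for \<alpha>
  proof -
    show "single_valued (tau \<Lambda> \<alpha>)" unfolding tau_def single_valued_def by blast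
    show "single_valued ((tau \<Lambda> \<alpha>)\<inverse>)"
    proof (rule single_valuedI)
      fix x y z assume "(x, y) \<in> (tau \<Lambda> \<alpha>)\<inverse>" "(x, z) \<in> (tau \<Lambda> \<alpha>)\<inverse>"
      then have "y \<in> right_ideal \<Lambda> (src \<Lambda> \<alpha>)" "z \<in> right_ideal \<Lambda> (src \<Lambda> \<alpha>)"
        "cmp \<Lambda> \<alpha> y = cmp \<Lambda> \<alpha> z" unfolding tau_def by auto
      then show "y = z" using ri[OF that] assms(2) that unfolding left_cancellative_def by metis
    qed
  qed
  have "single_valued s \<and> single_valued (s\<inverse>)" if "s \<in> cat_semigroup \<Lambda>" for s
    using that
    by induction (simp_all add: gen sigma_def converse_relcomp single_valued_relcomp)
  then show "single_valued s" if "s \<in> cat_semigroup \<Lambda>" for s using that by blast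
qed (auto intro: cat_semigroup.intros)

end

theory Submission
  imports Defs
begin

text \<open>
  For a nonzero idempotent \<open>f\<close>, the tight filters containing some \<open>s f s\<^sup>*\<close> form the smallest open
  invariant set containing all tight filters through \<open>f\<close>. If the groupoid is minimal, this set is the
  whole space, and compactness of the set of tight filters through \<open>e\<close> leaves finitely many \<open>s\<^sub>i f s\<^sub>i\<^sup>*\<close>,
  which then form an outer cover of \<open>e\<close>. Conversely, a tight filter containing \<open>e\<close> meets every finite
  outer cover of \<open>e\<close>, so it is carried by some \<open>s\<^sub>i\<^sup>*\<close> to a tight filter containing \<open>f\<close>; since every
  ultrafilter in an open set \<open>U\<close> contains an \<open>f\<close> such that all tight filters through \<open>f\<close> lie in \<open>U\<close>,
  a nonempty open invariant set is everything.

  By finite alignment every element of the semigroup is a finite union of maps \<open>x z \<mapsto> y z\<close> with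
  \<open>s(x) = s(y)\<close>, so every idempotent is the identity on a finite union of right ideals. If
  \<open>s\<close> maps \<open>\<beta>\<delta>\<close> to \<open>\<gamma>\<close>, then \<open>s(\<delta>) = s(\<gamma>)\<close>, which turns the right ideals making up an outer
  cover of \<open>\<alpha>\<Lambda>\<close> into the required exhaustive set; conversely \<open>\<tau>\<^sup>\<gamma> \<sigma>\<^bsup>\<beta>\<delta>\<^esup>\<close> conjugates \<open>\<beta>\<Lambda>\<close> onto a set
  containing \<open>\<gamma>\<Lambda>\<close>.
\<close>

section \<open>Tight filters\<close>

text \<open>Closure under binary intersections makes the generators a basis; it is what carries the
  intersection case of the induction over generated open sets.\<close>

lemma openin_topology_generated_by_basis:
  assumes "openin (topology_generated_by B) U" "x \<in> U"
    and "\<And>b c. b \<in> B \<Longrightarrow> c \<in> B \<Longrightarrow> b \<inter> c \<in> B"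
  shows "\<exists>b\<in>B. x \<in> b \<and> b \<subseteq> U"
proof -
  have "generate_topology_on B U" using assms(1) by (simp add: openin_topology_generated_by_iff)
  then have "\<forall>x\<in>U. \<exists>b\<in>B. x \<in> b \<and> b \<subseteq> U"
  proof induction
    case (Int a b)
    show ?case
    proof
      fix x assume "x \<in> a \<inter> b"
      with Int.IH obtain c d where "c \<in> B" "x \<in> c" "c \<subseteq> a" "d \<in> B" "x \<in> d" "d \<subseteq> b" by blast
      with assms(3)[of c d] show "\<exists>e\<in>B. x \<in> e \<and> e \<subseteq> a \<inter> b" by blast
    qed
  next
    case (UN K)
    then show ?case by (meson Union_iff Union_upper order_trans)
  qed blast+
  with assms(2) show ?thesis by blast
qed

context pbij_semigroup
begin

section \<open>Idempotents as subsets of the identity\<close>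

lemma idems_iff: "e \<in> idems S \<longleftrightarrow> e \<in> S \<and> e \<subseteq> Id"
  using idem_Id unfolding idems_def by blast

lemma mult_idems: "e \<subseteq> Id \<Longrightarrow> f \<subseteq> Id \<Longrightarrow> e \<odot> f = e \<inter> f"
  by blast

lemma idems_Int:
  assumes "e \<in> idems S" "f \<in> idems S" shows "e \<inter> f \<in> idems S"
proof -
  have "e \<odot> f = e \<inter> f" using assms by (intro mult_idems) (auto simp: idems_iff)
  then show ?thesis using mult_closed[of e f] assms unfolding idems_iff by auto
qed

lemma idems_conj:
  assumes "s \<in> S" "e \<in> idems S" shows "s \<odot> e \<odot> s\<inverse> \<in> idems S"
proof -
  have "s \<odot> e \<odot> s\<inverse> \<in> S"
    using assms by (intro mult_closed star_closed) (auto simp: idems_iff)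
  then show ?thesis using conj_Id[OF assms(1)] assms(2) unfolding idems_iff by blast
qed

lemma idems_star_mult:
  assumes "s \<in> S" shows "s\<inverse> \<odot> s \<in> idems S"
  using mult_closed[OF star_closed[OF assms] assms] single_valuedD[OF sv[OF star_closed[OF assms]]]
  unfolding idems_iff by blast

lemma idem_le_subset: "e \<in> idems S \<Longrightarrow> f \<in> idems S \<Longrightarrow> idem_le e f \<longleftrightarrow> e \<subseteq> f"
  by (rule idem_le_iff) (rule idem_Id, assumption)+

lemma idem_mult: "e \<in> idems S \<Longrightarrow> f \<in> idems S \<Longrightarrow> e \<odot> f = e \<inter> f"
  by (rule mult_idems) (rule idem_Id, assumption)+

text \<open>On subsets of the identity the order is inclusion and the product is intersection, so
  covers, and likewise filters, become statements about sets. The later arguments use this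
  form.\<close>

lemma outer_cover_iff:
  assumes "e \<in> idems S"
  shows "outer_cover S e Z \<longleftrightarrow> Z \<subseteq> idems S \<and>
    (\<forall>f\<in>idems S. f \<noteq> {} \<and> f \<subseteq> e \<longrightarrow> (\<exists>z\<in>Z. z \<inter> f \<noteq> {}))"
  unfolding outer_cover_def using assms
  by (intro conj_cong refl ball_cong imp_cong bex_cong) (auto simp: idem_le_subset idem_mult subset_iff simp del: relcomp_empty1)

lemma filters_iff: "\<eta> \<in> filters S \<longleftrightarrow> \<eta> \<subseteq> idems S \<and> \<eta> \<noteq> {} \<and> {} \<notin> \<eta> \<and>
    (\<forall>e\<in>\<eta>. \<forall>f\<in>idems S. e \<subseteq> f \<longrightarrow> f \<in> \<eta>) \<and> (\<forall>e\<in>\<eta>. \<forall>f\<in>\<eta>. e \<inter> f \<in> \<eta>)"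
proof -
  have "(idem_le e f \<longrightarrow> f \<in> \<eta>) = (e \<subseteq> f \<longrightarrow> f \<in> \<eta>)" if "\<eta> \<subseteq> idems S" "e \<in> \<eta>" "f \<in> idems S" for e f
    using idem_le_subset[OF subsetD[OF that(1,2)] that(3)] by simp
  moreover have "(e \<odot> f \<in> \<eta>) = (e \<inter> f \<in> \<eta>)" if "\<eta> \<subseteq> idems S" "e \<in> \<eta>" "f \<in> \<eta>" for e f
    using idem_mult[OF subsetD[OF that(1,2)] subsetD[OF that(1,3)]] by simp
  ultimately show ?thesis unfolding filters_def mem_Collect_eq
    by (intro conj_cong refl ball_cong)
qed

section \<open>Filters and ultrafilters of idempotents\<close>

lemma filter_ex: "\<eta> \<in> filters S \<Longrightarrow> \<exists>e. e \<in> \<eta>"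
  unfolding filters_def by blast

lemma filter_idems: "\<eta> \<in> filters S \<Longrightarrow> e \<in> \<eta> \<Longrightarrow> e \<in> idems S"
  by (auto simp: filters_def)

lemma filter_nonempty: "\<eta> \<in> filters S \<Longrightarrow> e \<in> \<eta> \<Longrightarrow> e \<noteq> {}"
  by (auto simp: filters_def)

lemma filter_up: "\<eta> \<in> filters S \<Longrightarrow> e \<in> \<eta> \<Longrightarrow> f \<in> idems S \<Longrightarrow> e \<subseteq> f \<Longrightarrow> f \<in> \<eta>"
  unfolding filters_iff by simp

lemma filter_Int: "\<eta> \<in> filters S \<Longrightarrow> e \<in> \<eta> \<Longrightarrow> f \<in> \<eta> \<Longrightarrow> e \<inter> f \<in> \<eta>"
  unfolding filters_iff by simp

lemma ultrafilter_filter: "\<eta> \<in> ultrafilters S \<Longrightarrow> \<eta> \<in> filters S"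
  by (simp add: ultrafilters_def)

text \<open>The hypotheses make \<open>B\<close> a filter base: directedness supplies an element of
  \<open>B\<close> below any intersection of two sets that lie above elements of
  \<open>B\<close>.\<close>

lemma filter_generated:
  assumes "B \<subseteq> idems S" "B \<noteq> {}" "{} \<notin> B" "\<And>b c. b \<in> B \<Longrightarrow> c \<in> B \<Longrightarrow> \<exists>d\<in>B. d \<subseteq> b \<inter> c"
  shows "{f \<in> idems S. \<exists>b\<in>B. b \<subseteq> f} \<in> filters S"
  unfolding filters_iff
proof (intro conjI ballI impI)
  show "{f \<in> idems S. \<exists>b\<in>B. b \<subseteq> f} \<noteq> {}" using assms(1,2) by blast
  show "{} \<notin> {f \<in> idems S. \<exists>b\<in>B. b \<subseteq> f}" using assms(3) by auto
  fix e f assume "e \<in> {f \<in> idems S. \<exists>b\<in>B. b \<subseteq> f}" "f \<in> {f \<in> idems S. \<exists>b\<in>B. b \<subseteq> f}"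
  then obtain b c where "b \<in> B" "b \<subseteq> e" "c \<in> B" "c \<subseteq> f" "e \<inter> f \<in> idems S"
    using idems_Int by blast
  moreover obtain d where "d \<in> B" "d \<subseteq> b \<inter> c" using assms(4) calculation by blast
  ultimately show "e \<inter> f \<in> {f \<in> idems S. \<exists>b\<in>B. b \<subseteq> f}" by blast
next
  fix e f assume "e \<in> {f \<in> idems S. \<exists>b\<in>B. b \<subseteq> f}" "f \<in> idems S" "e \<subseteq> f"
  then show "f \<in> {f \<in> idems S. \<exists>b\<in>B. b \<subseteq> f}" by blast
qed (rule Collect_restrict)

text \<open>Zorn's lemma. The union of a chain of filters is a filter because any two of its
  elements already lie in one filter of the chain.\<close>

lemma ultrafilter_extends:
  assumes "\<eta> \<in> filters S" shows "\<exists>\<xi>\<in>ultrafilters S. \<eta> \<subseteq> \<xi>"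
proof -
  let ?A = "{\<xi> \<in> filters S. \<eta> \<subseteq> \<xi>}"
  have "\<exists>M\<in>?A. \<forall>X\<in>?A. M \<subseteq> X \<longrightarrow> X = M"
  proof (rule subset_Zorn_nonempty)
    show "?A \<noteq> {}" using assms by blast
    fix C assume C: "C \<noteq> {}" "subset.chain ?A C"
    then have sub: "C \<subseteq> ?A" and lin: "\<And>x y. x \<in> C \<Longrightarrow> y \<in> C \<Longrightarrow> x \<subseteq> y \<or> y \<subseteq> x"
      unfolding subset.chain_def by blast+
    have CF: "x \<in> filters S" if "x \<in> C" for x using sub that by blast
    have "\<Union>C \<in> filters S" unfolding filters_iff
    proof (intro conjI ballI impI)
      fix e f assume "e \<in> \<Union>C" "f \<in> \<Union>C"
      then obtain x y where xy: "x \<in> C" "y \<in> C" "e \<in> x" "f \<in> y" by blast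
      obtain z where "z \<in> C" "e \<in> z" "f \<in> z" using lin[OF xy(1,2)] xy by blast
      then show "e \<inter> f \<in> \<Union>C" using filter_Int[OF CF] by blast
    next
      obtain x where "x \<in> C" using C(1) by blast
      then show "\<Union>C \<noteq> {}" using filter_ex[OF CF] by blast
      show "{} \<notin> \<Union>C" using filter_nonempty[OF CF] by blast
      show "\<Union>C \<subseteq> idems S" using filter_idems[OF CF] by blast
      fix e f assume e: "e \<in> \<Union>C" and f: "f \<in> idems S" "e \<subseteq> f"
      from e obtain x where "x \<in> C" "e \<in> x" by blast
      then show "f \<in> \<Union>C" using filter_up[OF CF _ f] by blast
    qed
    then show "\<Union>C \<in> ?A" using C(1) sub by blast
  qed
  then obtain M where M: "M \<in> filters S" "\<eta> \<subseteq> M"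
    "\<And>\<xi>. \<xi> \<in> filters S \<Longrightarrow> \<eta> \<subseteq> \<xi> \<Longrightarrow> M \<subseteq> \<xi> \<Longrightarrow> \<xi> = M" by auto
  have "M \<in> ultrafilters S"
    unfolding ultrafilters_def using M(1) M(3)[OF _ order_trans[OF M(2)]] by simp
  then show ?thesis using M(2) by blast
qed

text \<open>Extends the principal filter of \<open>e\<close>.\<close>

lemma ultrafilter_containing:
  assumes "e \<in> idems S" "e \<noteq> {}" shows "\<exists>\<xi>\<in>ultrafilters S. e \<in> \<xi>"
proof -
  have "{f \<in> idems S. \<exists>b\<in>{e}. b \<subseteq> f} \<in> filters S" by (rule filter_generated) (use assms in auto)
  from ultrafilter_extends[OF this] assms(1) show ?thesis by blast
qed

text \<open>Otherwise the traces \<open>g \<inter> y\<close> of the elements of \<open>\<xi>\<close>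
  form a filter base, and the filter generated by them contains both \<open>\<xi>\<close> and
  \<open>y\<close>, against maximality.\<close>

lemma ultrafilter_disjoint:
  assumes "\<xi> \<in> ultrafilters S" "y \<in> idems S" "y \<notin> \<xi>" shows "\<exists>g\<in>\<xi>. g \<inter> y = {}"
proof (rule ccontr)
  assume none: "\<not> ?thesis"
  have \<xi>: "\<xi> \<in> filters S" using ultrafilter_filter assms(1) .
  let ?\<zeta> = "{f \<in> idems S. \<exists>b\<in>(\<lambda>g. g \<inter> y) ` \<xi>. b \<subseteq> f}"
  have "?\<zeta> \<in> filters S"
  proof (rule filter_generated)
    show "(\<lambda>g. g \<inter> y) ` \<xi> \<subseteq> idems S" using idems_Int assms(2) filter_idems[OF \<xi>] by blast
    show "(\<lambda>g. g \<inter> y) ` \<xi> \<noteq> {}" using filter_ex[OF \<xi>] by blast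
    show "{} \<notin> (\<lambda>g. g \<inter> y) ` \<xi>" using none by auto
    fix b c assume "b \<in> (\<lambda>g. g \<inter> y) ` \<xi>" "c \<in> (\<lambda>g. g \<inter> y) ` \<xi>"
    then obtain g h where "g \<in> \<xi>" "h \<in> \<xi>" "b = g \<inter> y" "c = h \<inter> y" by blast
    then have "g \<inter> h \<in> \<xi>" "(g \<inter> h) \<inter> y \<subseteq> b \<inter> c" using filter_Int[OF \<xi>] by auto
    then show "\<exists>d\<in>(\<lambda>g. g \<inter> y) ` \<xi>. d \<subseteq> b \<inter> c" by (rule rev_bexI[OF imageI])
  qed
  moreover have "\<xi> \<subseteq> ?\<zeta>"
  proof
    fix g assume g: "g \<in> \<xi>"
    then have "g \<inter> y \<in> (\<lambda>g. g \<inter> y) ` \<xi>" "g \<inter> y \<subseteq> g" by auto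
    then show "g \<in> ?\<zeta>" using filter_idems[OF \<xi> g] by blast
  qed
  ultimately have "?\<zeta> = \<xi>" using assms(1) unfolding ultrafilters_def by simp
  moreover have "y \<in> ?\<zeta>"
  proof -
    obtain g where "g \<in> \<xi>" using filter_ex[OF \<xi>] by blast
    then have "g \<inter> y \<in> (\<lambda>g. g \<inter> y) ` \<xi>" "g \<inter> y \<subseteq> y" by auto
    then show ?thesis using assms(2) by blast
  qed
  ultimately show False using assms(3) by simp
qed

text \<open>Each requirement \<open>P a\<close> passes to smaller sets, so intersecting the
  individual witnesses satisfies finitely many of them at once.\<close>

lemma filter_lower_bound:
  assumes "\<xi> \<in> filters S" "finite A" "\<And>a. a \<in> A \<Longrightarrow> \<exists>g\<in>\<xi>. P a g"
    and "\<And>a g h. a \<in> A \<Longrightarrow> P a g \<Longrightarrow> h \<subseteq> g \<Longrightarrow> P a h"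
  shows "\<exists>g\<in>\<xi>. \<forall>a\<in>A. P a g"
  using assms(2,3,4)
proof (induction A)
  case empty
  then show ?case using filter_ex[OF assms(1)] by blast
next
  case (insert a A)
  then obtain g h where gh: "g \<in> \<xi>" "\<forall>a\<in>A. P a g" "h \<in> \<xi>" "P a h" by (metis insert_iff)
  then have "\<forall>b\<in>insert a A. P b (g \<inter> h)" using insert.prems(2) by (metis Int_lower1 Int_lower2 insert_iff)
  then show ?case using filter_Int[OF assms(1) gh(1,3)] by blast
qed

text \<open>Reduces a basic neighbourhood of an ultrafilter to one idempotent: every filter through
  such an \<open>f\<close> contains all of \<open>X\<close> and nothing of \<open>Y\<close>.\<close>

lemma ultrafilter_nbhd:
  assumes "\<xi> \<in> ultrafilters S" "finite X" "X \<subseteq> \<xi>" "finite Y" "Y \<subseteq> idems S" "Y \<inter> \<xi> = {}"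
  shows "\<exists>f\<in>\<xi>. (\<forall>x\<in>X. f \<subseteq> x) \<and> (\<forall>y\<in>Y. f \<inter> y = {})"
proof -
  have \<xi>: "\<xi> \<in> filters S" using ultrafilter_filter assms(1) .
  have "\<exists>f\<in>\<xi>. \<forall>x\<in>X. f \<subseteq> x" by (rule filter_lower_bound[OF \<xi> assms(2)]) (use assms(3) in blast)+
  moreover have "\<exists>g\<in>\<xi>. \<forall>y\<in>Y. g \<inter> y = {}"
    by (rule filter_lower_bound[OF \<xi> assms(4)]) (use assms(5,6) ultrafilter_disjoint[OF assms(1)] in blast)+
  ultimately obtain f g where "f \<in> \<xi>" "\<forall>x\<in>X. f \<subseteq> x" "g \<in> \<xi>" "\<forall>y\<in>Y. g \<inter> y = {}" by blast
  then have "f \<inter> g \<in> \<xi>" "\<forall>x\<in>X. f \<inter> g \<subseteq> x" "\<forall>y\<in>Y. (f \<inter> g) \<inter> y = {}"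
    using filter_Int[OF \<xi>] by auto
  then show ?thesis by (intro bexI[of _ "f \<inter> g"] conjI)
qed

section \<open>Basic open sets and the space of tight filters\<close>

definition nbhd :: "'a pmap set \<Rightarrow> 'a pmap set \<Rightarrow> 'a pmap set set" where
  "nbhd X Y = {\<eta> \<in> filters S. X \<subseteq> \<eta> \<and> Y \<inter> \<eta> = {}}"

definition nbhds :: "'a pmap set set set" where
  "nbhds = {nbhd X Y | X Y. finite X \<and> X \<subseteq> idems S \<and> finite Y \<and> Y \<subseteq> idems S}"

lemma nbhdI: "\<eta> \<in> filters S \<Longrightarrow> X \<subseteq> \<eta> \<Longrightarrow> Y \<inter> \<eta> = {} \<Longrightarrow> \<eta> \<in> nbhd X Y"
  by (simp add: nbhd_def)

lemma nbhdD:
  assumes "\<eta> \<in> nbhd X Y" shows "\<eta> \<in> filters S" "X \<subseteq> \<eta>" "Y \<inter> \<eta> = {}"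
  using assms by (simp_all add: nbhd_def)

lemma nbhdsI:
  "finite X \<Longrightarrow> X \<subseteq> idems S \<Longrightarrow> finite Y \<Longrightarrow> Y \<subseteq> idems S \<Longrightarrow> nbhd X Y \<in> nbhds"
  unfolding nbhds_def by blast

lemma nbhdsE:
  assumes "N \<in> nbhds"
  obtains X Y where "N = nbhd X Y" "finite X" "X \<subseteq> idems S" "finite Y" "Y \<subseteq> idems S"
  using assms unfolding nbhds_def by blast

lemma filter_topology_nbhds: "filter_topology S = topology_generated_by nbhds"
  unfolding filter_topology_def nbhds_def nbhd_def ..

lemma nbhds_Int:
  assumes "M \<in> nbhds" "N \<in> nbhds" shows "M \<inter> N \<in> nbhds"
proof -
  obtain X Y where M: "M = nbhd X Y" "finite X" "X \<subseteq> idems S" "finite Y" "Y \<subseteq> idems S"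
    using assms(1) by (rule nbhdsE)
  obtain X' Y' where N: "N = nbhd X' Y'" "finite X'" "X' \<subseteq> idems S" "finite Y'" "Y' \<subseteq> idems S"
    using assms(2) by (rule nbhdsE)
  have "M \<inter> N = nbhd (X \<union> X') (Y \<union> Y')" unfolding M(1) N(1) nbhd_def by blast
  then show ?thesis using M N by (simp add: nbhdsI)
qed

lemma openin_filter_topology_nbhd: "N \<in> nbhds \<Longrightarrow> openin (filter_topology S) N"
  unfolding filter_topology_nbhds by (rule topology_generated_by_Basis)

lemma openin_filter_topologyD:
  assumes "openin (filter_topology S) U" "\<eta> \<in> U" shows "\<exists>N\<in>nbhds. \<eta> \<in> N \<and> N \<subseteq> U"
  using assms(1) unfolding filter_topology_nbhds
  by (rule openin_topology_generated_by_basis[OF _ assms(2) nbhds_Int])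

lemma topspace_filter_topology: "topspace (filter_topology S) = filters S"
proof -
  have "\<Union>nbhds \<subseteq> filters S" unfolding nbhds_def nbhd_def by blast
  moreover have "nbhd {} {} = filters S" by (simp add: nbhd_def)
  moreover have "nbhd {} {} \<in> nbhds" by (rule nbhdsI) auto
  ultimately show ?thesis unfolding filter_topology_nbhds topology_generated_by_topspace by blast
qed

text \<open>Membership in a closure can be tested on a basis. This frees later arguments about
  single filters from general open sets.\<close>

lemma tight_iff: "\<eta> \<in> tight_filters S \<longleftrightarrow> \<eta> \<in> filters S \<and>
    (\<forall>N\<in>nbhds. \<eta> \<in> N \<longrightarrow> (\<exists>\<xi>\<in>ultrafilters S. \<xi> \<in> N))"
proof -
  have "(\<forall>U. \<eta> \<in> U \<and> openin (filter_topology S) U \<longrightarrow> (\<exists>\<xi>\<in>ultrafilters S. \<xi> \<in> U)) \<longleftrightarrow>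
      (\<forall>N\<in>nbhds. \<eta> \<in> N \<longrightarrow> (\<exists>\<xi>\<in>ultrafilters S. \<xi> \<in> N))" (is "?L \<longleftrightarrow> ?R")
  proof
    show "?L \<Longrightarrow> ?R" using openin_filter_topology_nbhd by simp
    show ?L if R: ?R
    proof (intro allI impI)
      fix U assume "\<eta> \<in> U \<and> openin (filter_topology S) U"
      then obtain N where "N \<in> nbhds" "\<eta> \<in> N" "N \<subseteq> U" using openin_filter_topologyD by blast
      with R show "\<exists>\<xi>\<in>ultrafilters S. \<xi> \<in> U" by blast
    qed
  qed
  then show ?thesis unfolding tight_filters_def in_closure_of topspace_filter_topology Bex_def by simp
qed

lemma ultrafilter_tight: "\<xi> \<in> ultrafilters S \<Longrightarrow> \<xi> \<in> tight_filters S"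
  unfolding tight_iff using ultrafilter_filter by blast

lemma topspace_tight_topology: "topspace (tight_topology S) = tight_filters S"
  unfolding tight_topology_def topspace_subtopology topspace_filter_topology using tight_filter by blast

lemma openin_tight_topology_nbhd: "N \<in> nbhds \<Longrightarrow> openin (tight_topology S) (N \<inter> tight_filters S)"
  unfolding tight_topology_def openin_subtopology using openin_filter_topology_nbhd by blast

lemma openin_tight_topologyD:
  assumes "openin (tight_topology S) U" "\<eta> \<in> U"
  shows "\<exists>N\<in>nbhds. \<eta> \<in> N \<and> N \<inter> tight_filters S \<subseteq> U"
proof -
  obtain V where V: "openin (filter_topology S) V" "U = V \<inter> tight_filters S"
    using assms(1) unfolding tight_topology_def openin_subtopology by blast
  then obtain N where "N \<in> nbhds" "\<eta> \<in> N" "N \<subseteq> V" using openin_filter_topologyD assms(2) by blast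
  then show ?thesis using V(2) by blast
qed

text \<open>This is compactness of the set of tight filters through \<open>e\<close>, for the cover by the sets of filters
  containing a given element of \<open>J\<close>.\<close>

lemma tight_avoiding:
  assumes "\<And>Z. finite Z \<Longrightarrow> Z \<subseteq> J \<Longrightarrow> \<exists>\<eta>\<in>ultrafilters S. e \<in> \<eta> \<and> Z \<inter> \<eta> = {}"
  shows "\<exists>\<eta>\<in>tight_filters S. e \<in> \<eta> \<and> J \<inter> \<eta> = {}"
proof -
  \<comment> \<open>Sets of partial maps are encoded by their characteristic functions, points of a
    power of the two-point discrete space, which is compact by Tychonoff's theorem.\<close>
  let ?T = "product_topology (\<lambda>_::'a pmap. discrete_topology (UNIV::bool set)) UNIV"
  define C where "C Z = ?T closure_of {\<lambda>x. x \<in> \<eta> | \<eta>. \<eta> \<in> ultrafilters S \<and> e \<in> \<eta> \<and> Z \<inter> \<eta> = {}}" for Z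
  let ?K = "C ` {Z. finite Z \<and> Z \<subseteq> J}"
  have "compact_space ?T"
    by (simp add: compact_space_product_topology compact_space_discrete_topology)
  note inter = compact_space_fip[THEN iffD1, OF this, THEN spec, THEN mp, OF conjI]
  \<comment> \<open>Finitely many finite sets \<open>Z\<close> have a finite union, and an
    ultrafilter avoiding that union lies in all the corresponding sets \<open>C Z\<close>.\<close>
  have fip: "\<Inter>\<F> \<noteq> {}" if \<F>: "finite \<F>" "\<F> \<subseteq> ?K" for \<F>
  proof -
    obtain \<Z> where \<Z>: "\<Z> \<subseteq> {Z. finite Z \<and> Z \<subseteq> J}" "finite \<Z>" "\<F> = C ` \<Z>"
      using finite_subset_image[OF \<F>] by blast
    then have "finite (\<Union>\<Z>)" "\<Union>\<Z> \<subseteq> J" by blast+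
    from assms[OF this] obtain \<eta> where \<eta>: "\<eta> \<in> ultrafilters S" "e \<in> \<eta>" "\<Union>\<Z> \<inter> \<eta> = {}"
      by blast
    have "(\<lambda>x. x \<in> \<eta>) \<in> C Z" if "Z \<in> \<Z>" for Z
    proof -
      have "(\<lambda>x. x \<in> \<eta>) \<in> {\<lambda>x. x \<in> \<eta> | \<eta>. \<eta> \<in> ultrafilters S \<and> e \<in> \<eta> \<and> Z \<inter> \<eta> = {}}"
        using \<eta> that by blast
      then show ?thesis unfolding C_def by (rule subsetD[OF closure_of_subset, rotated]) simp
    qed
    then show ?thesis unfolding \<Z>(3) by blast
  qed
  have "\<Inter>?K \<noteq> {}"
  proof (rule inter)
    show "\<forall>c\<in>?K. closedin ?T c" unfolding C_def by auto
    show "\<forall>\<F>. finite \<F> \<and> \<F> \<subseteq> ?K \<longrightarrow> \<Inter>\<F> \<noteq> {}" using fip by simp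
  qed
  then obtain u where "u \<in> \<Inter>?K" by blast
  then have u: "u \<in> C Z" if "finite Z" "Z \<subseteq> J" for Z using that by blast
  \<comment> \<open>A common point of all the closures; it remains to see that the set it encodes is
    a tight filter.\<close>
  define \<eta> where "\<eta> = {x. u x}"
  \<comment> \<open>The cylinder around \<open>u\<close> that fixes the coordinates in
    \<open>A\<close> is open, so it meets the set whose closure is \<open>C Z\<close>. Hence on
    every finite set \<open>\<eta>\<close> looks like an ultrafilter that contains \<open>e\<close>
    and avoids \<open>Z\<close>.\<close>
  have approx: "\<exists>\<xi>\<in>ultrafilters S. e \<in> \<xi> \<and> Z \<inter> \<xi> = {} \<and> (\<forall>a\<in>A. a \<in> \<xi> \<longleftrightarrow> a \<in> \<eta>)"
    if fin: "finite A" "finite Z" "Z \<subseteq> J" for A Z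
  proof -
    let ?V = "\<Pi>\<^sub>E i\<in>UNIV. if i \<in> A then {u i} else UNIV"
    have "finite {i. (if i \<in> A then {u i} else UNIV) \<noteq> (UNIV::bool set)}"
      by (rule finite_subset[OF _ fin(1)]) auto
    then have "openin ?T ?V" by (intro product_topology_basis) auto
    moreover have "u \<in> ?V" by auto
    ultimately obtain w where "w \<in> {\<lambda>x. x \<in> \<eta> | \<eta>. \<eta> \<in> ultrafilters S \<and> e \<in> \<eta> \<and> Z \<inter> \<eta> = {}}" "w \<in> ?V"
      using u[OF fin(2,3)] unfolding C_def in_closure_of by meson
    then obtain \<xi> where \<xi>: "\<xi> \<in> ultrafilters S" "e \<in> \<xi>" "Z \<inter> \<xi> = {}" "(\<lambda>x. x \<in> \<xi>) \<in> ?V" by blast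
    have "a \<in> \<xi> \<longleftrightarrow> a \<in> \<eta>" if "a \<in> A" for a
    proof -
      have "(a \<in> \<xi>) \<in> (if a \<in> A then {u a} else UNIV)" using PiE_mem[OF \<xi>(4), of a] by simp
      then show ?thesis using that unfolding \<eta>_def by simp
    qed
    then show ?thesis using \<xi> by blast
  qed
  have agree: "\<exists>\<xi>\<in>filters S. \<forall>a\<in>A. a \<in> \<xi> \<longleftrightarrow> a \<in> \<eta>" if "finite A" for A
    using approx[OF that, of "{}"] ultrafilter_filter by blast
  have e: "e \<in> \<eta>" using approx[of "{e}" "{}"] by auto
  have J: "J \<inter> \<eta> = {}"
  proof -
    have "z \<notin> \<eta>" if "z \<in> J" for z using approx[of "{z}" "{z}"] that by auto
    then show ?thesis by blast
  qed
  \<comment> \<open>Every filter axiom can be checked on at most three partial maps at a time, so it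
    is inherited from an ultrafilter agreeing with \<open>\<eta>\<close> on them.\<close>
  have \<eta>: "\<eta> \<in> filters S" unfolding filters_iff
  proof (intro conjI ballI impI subsetI)
    show "\<eta> \<noteq> {}" using e by blast
    show "{} \<notin> \<eta>" using agree[of "{{}}"] filter_nonempty by auto
    show "x \<in> idems S" if "x \<in> \<eta>" for x using agree[of "{x}"] that filter_idems by auto
    fix f g
    show "g \<in> \<eta>" if fg: "f \<in> \<eta>" "g \<in> idems S" "f \<subseteq> g"
    proof -
      obtain \<xi> where \<xi>: "\<xi> \<in> filters S" "f \<in> \<xi> \<longleftrightarrow> f \<in> \<eta>" "g \<in> \<xi> \<longleftrightarrow> g \<in> \<eta>"
        using agree[of "{f, g}"] by auto
      then show ?thesis using filter_up[OF \<xi>(1) _ fg(2,3)] fg(1) by simp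
    qed
    show "f \<inter> g \<in> \<eta>" if fg: "f \<in> \<eta>" "g \<in> \<eta>"
    proof -
      obtain \<xi> where \<xi>: "\<xi> \<in> filters S" "f \<in> \<xi> \<longleftrightarrow> f \<in> \<eta>" "g \<in> \<xi> \<longleftrightarrow> g \<in> \<eta>"
        "f \<inter> g \<in> \<xi> \<longleftrightarrow> f \<inter> g \<in> \<eta>" using agree[of "{f, g, f \<inter> g}"] by auto
      then show ?thesis using filter_Int[OF \<xi>(1)] fg by simp
    qed
  qed
  \<comment> \<open>A basic neighbourhood tests only the finitely many elements of
    \<open>X \<union> Y\<close>.\<close>
  moreover have "\<exists>\<xi>\<in>ultrafilters S. \<xi> \<in> N" if N\<eta>: "N \<in> nbhds" "\<eta> \<in> N" for N
  proof -
    obtain X Y where N: "N = nbhd X Y" "finite X" "X \<subseteq> idems S" "finite Y" "Y \<subseteq> idems S"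
      using N\<eta>(1) by (rule nbhdsE)
    then obtain \<xi> where \<xi>: "\<xi> \<in> ultrafilters S" "\<forall>a\<in>X \<union> Y. a \<in> \<xi> \<longleftrightarrow> a \<in> \<eta>"
      using approx[of "X \<union> Y" "{}"] by auto
    have "\<xi> \<in> N" unfolding N(1)
      by (rule nbhdI[OF ultrafilter_filter[OF \<xi>(1)]]) (use \<xi>(2) nbhdD[OF N\<eta>(2)[unfolded N(1)]] in blast)+
    then show ?thesis using \<xi>(1) by blast
  qed
  ultimately have "\<eta> \<in> tight_filters S" unfolding tight_iff by blast
  then show ?thesis using e J by blast
qed

section \<open>The action on tight filters\<close>

lemma mult_star_idems: "s \<in> S \<Longrightarrow> s \<odot> s\<inverse> \<in> idems S"
  using idems_star_mult[OF star_closed] by simp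

lemma conj_star: "s \<in> S \<Longrightarrow> e \<in> idems S \<Longrightarrow> s\<inverse> \<odot> e \<odot> s \<in> idems S"
  using idems_conj[OF star_closed] by simp

lemma pbij_single_valued: "s \<in> S \<Longrightarrow> (x, y) \<in> s \<Longrightarrow> (x, z) \<in> s \<Longrightarrow> y = z"
  using sv by (rule single_valuedD)

lemma pbij_injective: "s \<in> S \<Longrightarrow> (y, x) \<in> s \<Longrightarrow> (z, x) \<in> s \<Longrightarrow> y = z"
  using pbij_single_valued[OF star_closed] by blast

text \<open>Conjugation by \<open>s\<close> turns the identity on a set into the identity on the
  image of that set under \<open>s\<close>.\<close>

lemma conj_mem:
  assumes "s \<in> S" "e \<in> idems S"
  shows "(a, b) \<in> s \<odot> e \<odot> s\<inverse> \<longleftrightarrow> a = b \<and> (\<exists>x. (x, a) \<in> s \<and> (x, x) \<in> e)"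
  using idem_Id[OF assms(2)] pbij_single_valued[OF assms(1)] by blast

lemma conj_star_mem:
  assumes "s \<in> S" "e \<in> idems S"
  shows "(a, b) \<in> s\<inverse> \<odot> e \<odot> s \<longleftrightarrow> a = b \<and> (\<exists>x. (a, x) \<in> s \<and> (x, x) \<in> e)"
  using conj_mem[OF star_closed[OF assms(1)] assms(2)] by simp

text \<open>Injectivity of \<open>s\<close> brings back exactly the points of \<open>e\<close> in
  the domain of \<open>s\<close>, and \<open>s\<inverse> \<odot> s\<close> is the identity on that
  domain.\<close>

lemma conj_star_conj:
  assumes "s \<in> S" "e \<in> idems S"
  shows "s\<inverse> \<odot> (s \<odot> e \<odot> s\<inverse>) \<odot> s = e \<inter> (s\<inverse> \<odot> s)"
proof (rule set_eqI, clarify)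
  fix a b
  have "(a, b) \<in> s\<inverse> \<odot> (s \<odot> e \<odot> s\<inverse>) \<odot> s \<longleftrightarrow> a = b \<and> (\<exists>x. (a, x) \<in> s \<and> (\<exists>y. (y, x) \<in> s \<and> (y, y) \<in> e))"
    unfolding conj_star_mem[OF assms(1) idems_conj[OF assms]] conj_mem[OF assms] by simp
  also have "\<dots> \<longleftrightarrow> (a, b) \<in> e \<inter> (s\<inverse> \<odot> s)"
    using idem_Id[OF assms(2)] pbij_injective[OF assms(1)] by blast
  finally show "(a, b) \<in> s\<inverse> \<odot> (s \<odot> e \<odot> s\<inverse>) \<odot> s \<longleftrightarrow> (a, b) \<in> e \<inter> (s\<inverse> \<odot> s)" .
qed

text \<open>The action is the preimage of \<open>\<eta>\<close> under
  \<open>f \<mapsto> s\<inverse> \<odot> f \<odot> s\<close>. One direction enlarges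
  \<open>e \<inter> (s\<inverse> \<odot> s)\<close>; in the other the conjugate itself is the
  witness, since conjugating it back yields a part of \<open>f\<close>.\<close>

lemma act_conv:
  assumes "s \<in> S" "\<eta> \<in> filters S" "s\<inverse> \<odot> s \<in> \<eta>"
  shows "f \<in> act S s \<eta> \<longleftrightarrow> f \<in> idems S \<and> s\<inverse> \<odot> f \<odot> s \<in> \<eta>"
  unfolding act_iff[OF assms(1,2)]
proof (intro conj_cong refl iffI)
  assume f: "f \<in> idems S"
  show "s\<inverse> \<odot> f \<odot> s \<in> \<eta>" if ex: "\<exists>e\<in>\<eta>. s \<odot> e \<odot> s\<inverse> \<subseteq> f"
  proof -
    obtain e where e: "e \<in> \<eta>" "s \<odot> e \<odot> s\<inverse> \<subseteq> f" using ex by blast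
    have "e \<inter> (s\<inverse> \<odot> s) \<subseteq> s\<inverse> \<odot> f \<odot> s"
      unfolding conj_star_conj[OF assms(1) filter_idems[OF assms(2) e(1)], symmetric]
      by (intro relcomp_mono e(2) order_refl)
    then show ?thesis
      using filter_up[OF assms(2) filter_Int[OF assms(2) e(1) assms(3)] conj_star[OF assms(1) f]] by blast
  qed
  show "\<exists>e\<in>\<eta>. s \<odot> e \<odot> s\<inverse> \<subseteq> f" if \<eta>: "s\<inverse> \<odot> f \<odot> s \<in> \<eta>"
  proof -
    have "s \<odot> (s\<inverse> \<odot> f \<odot> s) \<odot> s\<inverse> \<subseteq> f"
      using conj_star_conj[OF star_closed[OF assms(1)] f] by simp
    then show ?thesis using \<eta> by blast
  qed
qed

text \<open>By \<open>act_conv\<close> the filter axioms are pulled back along conjugation, which is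
  monotone and respects intersections because \<open>s\<close> is single-valued.\<close>

lemma act_filter:
  assumes "s \<in> S" "\<eta> \<in> filters S" "s\<inverse> \<odot> s \<in> \<eta>"
  shows "act S s \<eta> \<in> filters S" "s \<odot> s\<inverse> \<in> act S s \<eta>"
proof -
  note mem = act_conv[OF assms]
  have "s\<inverse> \<odot> s \<subseteq> s\<inverse> \<odot> (s \<odot> s\<inverse>) \<odot> s" by blast
  then show ss: "s \<odot> s\<inverse> \<in> act S s \<eta>" unfolding mem
    using filter_up[OF assms(2,3)] conj_star[OF assms(1)] mult_star_idems[OF assms(1)] by blast
  show "act S s \<eta> \<in> filters S" unfolding filters_iff
  proof (intro conjI ballI impI)
    show "act S s \<eta> \<subseteq> idems S" using mem by blast
    show "act S s \<eta> \<noteq> {}" using ss by blast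
    show "{} \<notin> act S s \<eta>" using mem[of "{}"] filter_nonempty[OF assms(2)] by auto
  next
    fix e f assume e: "e \<in> act S s \<eta>" and f: "f \<in> idems S" "e \<subseteq> f"
    then have "s\<inverse> \<odot> e \<odot> s \<subseteq> s\<inverse> \<odot> f \<odot> s" by (intro relcomp_mono order_refl)
    then show "f \<in> act S s \<eta>"
      using e f unfolding mem using filter_up[OF assms(2) _ conj_star[OF assms(1) f(1)]] by blast
  next
    fix e f assume ef: "e \<in> act S s \<eta>" "f \<in> act S s \<eta>"
    then have id: "e \<in> idems S" "f \<in> idems S" "e \<inter> f \<in> idems S" using mem idems_Int by blast+
    have "(s\<inverse> \<odot> e \<odot> s) \<inter> (s\<inverse> \<odot> f \<odot> s) \<subseteq> s\<inverse> \<odot> (e \<inter> f) \<odot> s"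
    proof (rule subrelI, elim IntE)
      fix a b assume "(a, b) \<in> s\<inverse> \<odot> e \<odot> s" "(a, b) \<in> s\<inverse> \<odot> f \<odot> s"
      then obtain x y where "a = b" "(a, x) \<in> s" "(x, x) \<in> e" "(a, y) \<in> s" "(y, y) \<in> f"
        unfolding conj_star_mem[OF assms(1) id(1)] conj_star_mem[OF assms(1) id(2)] by blast
      moreover from this have "x = y" using pbij_single_valued[OF assms(1)] by simp
      ultimately show "(a, b) \<in> s\<inverse> \<odot> (e \<inter> f) \<odot> s"
        unfolding conj_star_mem[OF assms(1) id(3)] by blast
    qed
    moreover have "(s\<inverse> \<odot> e \<odot> s) \<inter> (s\<inverse> \<odot> f \<odot> s) \<in> \<eta>"
      using filter_Int[OF assms(2)] ef unfolding mem by blast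
    ultimately show "e \<inter> f \<in> act S s \<eta>" unfolding mem
      using filter_up[OF assms(2)] conj_star[OF assms(1) id(3)] id(3) by blast
  qed
qed

text \<open>Two uses of \<open>act_conv\<close> replace \<open>g\<close> by
  \<open>g \<inter> (s\<inverse> \<odot> s)\<close>, which belongs to \<open>\<eta>\<close> exactly
  when \<open>g\<close> does.\<close>

lemma act_star_act:
  assumes "s \<in> S" "\<eta> \<in> filters S" "s\<inverse> \<odot> s \<in> \<eta>"
  shows "act S (s\<inverse>) (act S s \<eta>) = \<eta>"
proof (rule set_eqI)
  fix g
  have "g \<in> act S (s\<inverse>) (act S s \<eta>) \<longleftrightarrow> g \<in> idems S \<and> s \<odot> g \<odot> s\<inverse> \<in> act S s \<eta>"
    using act_conv[OF star_closed[OF assms(1)] act_filter(1)[OF assms]] act_filter(2)[OF assms] by simp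
  also have "\<dots> \<longleftrightarrow> g \<in> idems S \<and> s\<inverse> \<odot> (s \<odot> g \<odot> s\<inverse>) \<odot> s \<in> \<eta>"
    using act_conv[OF assms] idems_conj[OF assms(1)] by blast
  also have "\<dots> \<longleftrightarrow> g \<in> idems S \<and> g \<inter> (s\<inverse> \<odot> s) \<in> \<eta>"
    using conj_star_conj[OF assms(1)] by (intro conj_cong refl) simp
  also have "\<dots> \<longleftrightarrow> g \<in> \<eta>"
    using filter_up[OF assms(2), of "g \<inter> (s\<inverse> \<odot> s)" g] filter_Int[OF assms(2) _ assms(3)] filter_idems[OF assms(2)]
    by blast
  finally show "g \<in> act S (s\<inverse>) (act S s \<eta>) \<longleftrightarrow> g \<in> \<eta>" .
qed

lemma act_mono: "\<eta> \<subseteq> \<zeta> \<Longrightarrow> act S s \<eta> \<subseteq> act S s \<zeta>"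
  unfolding act_def by blast

text \<open>A filter above \<open>act S s \<xi>\<close> is carried by \<open>s\<inverse>\<close> to
  a filter above \<open>\<xi>\<close>, so maximality of \<open>\<xi>\<close> transfers.\<close>

lemma act_ultrafilter:
  assumes "s \<in> S" "\<xi> \<in> ultrafilters S" "s\<inverse> \<odot> s \<in> \<xi>"
  shows "act S s \<xi> \<in> ultrafilters S"
proof -
  have \<xi>: "\<xi> \<in> filters S" using assms(2) by (rule ultrafilter_filter)
  have max: "\<zeta> = \<xi>" if "\<zeta> \<in> filters S" "\<xi> \<subseteq> \<zeta>" for \<zeta> using assms(2) that unfolding ultrafilters_def by simp
  have s': "s\<inverse> \<in> S" using assms(1) by (rule star_closed)
  have "\<zeta> = act S s \<xi>" if \<zeta>: "\<zeta> \<in> filters S" "act S s \<xi> \<subseteq> \<zeta>" for \<zeta>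
  proof -
    have ss: "(s\<inverse>)\<inverse> \<odot> s\<inverse> \<in> \<zeta>" using act_filter(2)[OF assms(1) \<xi> assms(3)] \<zeta>(2) by auto
    have "\<xi> \<subseteq> act S (s\<inverse>) \<zeta>" using act_mono[OF \<zeta>(2)] act_star_act[OF assms(1) \<xi> assms(3)] by blast
    then have "act S (s\<inverse>) \<zeta> = \<xi>" by (rule max[OF act_filter(1)[OF s' \<zeta>(1) ss]])
    then show ?thesis using act_star_act[OF s' \<zeta>(1) ss] by simp
  qed
  then show ?thesis using act_filter(1)[OF assms(1) \<xi> assms(3)] unfolding ultrafilters_def by simp
qed

text \<open>Continuity of the action combined with \<open>act_ultrafilter\<close>: ultrafilters near
  \<open>\<eta>\<close> are sent to ultrafilters near \<open>act S s \<eta>\<close>.\<close>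

lemma act_tight:
  assumes "s \<in> S" "\<eta> \<in> tight_filters S" "s\<inverse> \<odot> s \<in> \<eta>"
  shows "act S s \<eta> \<in> tight_filters S"
  unfolding tight_iff
proof (intro conjI ballI impI)
  have \<eta>: "\<eta> \<in> filters S" using assms(2) by (rule tight_filter)
  show "act S s \<eta> \<in> filters S" using act_filter(1)[OF assms(1) \<eta> assms(3)] .
  fix N assume N: "N \<in> nbhds" and mem: "act S s \<eta> \<in> N"
  obtain X Y where XY: "N = nbhd X Y" "finite X" "X \<subseteq> idems S" "finite Y" "Y \<subseteq> idems S"
    using N by (rule nbhdsE)
  note actXY = nbhdD(2,3)[OF mem[unfolded XY(1)]]
  let ?c = "\<lambda>f. s\<inverse> \<odot> f \<odot> s"
  \<comment> \<open>The pullback of \<open>N\<close> under the action;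
    \<open>s\<inverse> \<odot> s\<close> is added so that \<open>s\<close> acts on every filter in
    it.\<close>
  let ?M = "nbhd (insert (s\<inverse> \<odot> s) (?c ` X)) (?c ` Y)"
  have "?M \<in> nbhds"
    using XY conj_star[OF assms(1)] idems_star_mult[OF assms(1)] by (intro nbhdsI) auto
  moreover have "\<eta> \<in> ?M"
  proof (rule nbhdI[OF \<eta>])
    have "?c x \<in> \<eta>" if "x \<in> X" for x using act_conv[OF assms(1) \<eta> assms(3)] actXY(1) that by blast
    then show "insert (s\<inverse> \<odot> s) (?c ` X) \<subseteq> \<eta>" using assms(3) by auto
    have "?c y \<notin> \<eta>" if "y \<in> Y" for y
      using act_conv[OF assms(1) \<eta> assms(3)] actXY(2) that XY(5) by blast
    then show "?c ` Y \<inter> \<eta> = {}" by auto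
  qed
  ultimately obtain \<xi> where \<xi>: "\<xi> \<in> ultrafilters S" "\<xi> \<in> ?M" using assms(2) unfolding tight_iff by blast
  note \<xi>M = nbhdD[OF \<xi>(2)]
  have ss: "s\<inverse> \<odot> s \<in> \<xi>" using \<xi>M(2) by simp
  note mem\<xi> = act_conv[OF assms(1) \<xi>M(1) ss]
  have "act S s \<xi> \<in> N" unfolding XY(1)
  proof (rule nbhdI[OF act_filter(1)[OF assms(1) \<xi>M(1) ss]])
    show "X \<subseteq> act S s \<xi>" using mem\<xi> XY(3) \<xi>M(2) by auto
    show "Y \<inter> act S s \<xi> = {}" using mem\<xi> \<xi>M(3) by auto
  qed
  then show "\<exists>\<xi>\<in>ultrafilters S. \<xi> \<in> N" using act_ultrafilter[OF assms(1) \<xi>(1) ss] by blast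
qed

section \<open>Minimality\<close>

lemma topspace_arrow_space:
  "topspace (arrow_space (tight_groupoid S)) = (\<lambda>(s, \<eta>). germ S s \<eta>) ` germ_pairs S"
proof -
  have dom: "act_dom S s \<subseteq> tight_filters S" for s unfolding act_dom_def by blast
  have "topspace (arrow_space (tight_groupoid S)) =
      \<Union>{germ S s ` U | s U. s \<in> S \<and> openin (subtopology (tight_topology S) (act_dom S s)) U}"
    by (simp add: tight_groupoid_def topology_generated_by_topspace)
  also have "\<dots> = (\<Union>s\<in>S. germ S s ` act_dom S s)"
  proof (intro equalityI subsetI)
    fix g assume "g \<in> \<Union>{germ S s ` U | s U. s \<in> S \<and> openin (subtopology (tight_topology S) (act_dom S s)) U}"
    then obtain s U where "g \<in> germ S s ` U" "s \<in> S" "openin (subtopology (tight_topology S) (act_dom S s)) U"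
      by blast
    then show "g \<in> (\<Union>s\<in>S. germ S s ` act_dom S s)" using openin_imp_subset by blast
  next
    fix g assume "g \<in> (\<Union>s\<in>S. germ S s ` act_dom S s)"
    then obtain s where s: "s \<in> S" "g \<in> germ S s ` act_dom S s" by blast
    \<comment> \<open>The whole domain is open in itself, so the germ of \<open>s\<close> at each of
      its points lies in a generating set.\<close>
    have "openin (subtopology (tight_topology S) (act_dom S s)) (act_dom S s)"
      by (intro openin_subtopology_refl[THEN iffD2]) (simp add: topspace_tight_topology dom)
    then show "g \<in> \<Union>{germ S s ` U | s U. s \<in> S \<and> openin (subtopology (tight_topology S) (act_dom S s)) U}"
      using s by blast
  qed
  also have "\<dots> = (\<lambda>(s, \<eta>). germ S s \<eta>) ` germ_pairs S" unfolding germ_pairs_def by force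
  finally show ?thesis .
qed

text \<open>Every arrow is a germ of a pair, and \<open>dmap_germ\<close> and
  \<open>rmap_germ\<close> compute its ends; from here on only the action on filters
  matters.\<close>

lemma invariant_iff:
  "invariant_set (tight_groupoid S) U \<longleftrightarrow> U \<subseteq> tight_filters S \<and>
     (\<forall>s\<in>S. \<forall>\<eta>\<in>U. s\<inverse> \<odot> s \<in> \<eta> \<longrightarrow> act S s \<eta> \<in> U)"
proof -
  have "topspace (unit_space (tight_groupoid S)) = tight_filters S"
    by (simp add: tight_groupoid_def topspace_tight_topology)
  moreover have "(\<forall>g\<in>topspace (arrow_space (tight_groupoid S)).
        dmap (tight_groupoid S) g \<in> U \<longrightarrow> rmap (tight_groupoid S) g \<in> U) \<longleftrightarrow>
      (\<forall>(s, \<eta>)\<in>germ_pairs S. \<eta> \<in> U \<longrightarrow> act S s \<eta> \<in> U)"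
    unfolding topspace_arrow_space ball_simps by (intro ball_cong refl) (auto simp: dmap_germ rmap_germ)
  moreover have "(\<forall>(s, \<eta>)\<in>germ_pairs S. \<eta> \<in> U \<longrightarrow> act S s \<eta> \<in> U) \<longleftrightarrow>
      (\<forall>s\<in>S. \<forall>\<eta>\<in>U. s\<inverse> \<odot> s \<in> \<eta> \<longrightarrow> act S s \<eta> \<in> U)" if "U \<subseteq> tight_filters S"
    using that unfolding germ_pairs_def act_dom_def by auto
  ultimately show ?thesis unfolding invariant_set_def by auto
qed

lemma minimal_iff_invariant:
  "minimal_groupoid (tight_groupoid S) \<longleftrightarrow>
    (\<forall>U. openin (tight_topology S) U \<and> invariant_set (tight_groupoid S) U \<longrightarrow> U = {} \<or> U = tight_filters S)"
  unfolding minimal_groupoid_def by (simp add: tight_groupoid_def topspace_tight_topology)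

text \<open>By contradiction: if no finite family of conjugates of \<open>f\<close> covers
  \<open>e\<close>, compactness produces a tight filter containing none of the conjugates, hence
  outside an open invariant nonempty set.\<close>

lemma minimal_imp_outer_cover:
  assumes "minimal_groupoid (tight_groupoid S)" "e \<in> idems S" "f \<in> idems S" "e \<noteq> {}" "f \<noteq> {}"
  shows "\<exists>F\<subseteq>S. finite F \<and> outer_cover S e ((\<lambda>s. s \<odot> f \<odot> s\<inverse>) ` F)"
proof (rule ccontr)
  assume none: "\<not> ?thesis"
  let ?c = "\<lambda>s. s \<odot> f \<odot> s\<inverse>"
  define U where "U = (\<Union>s\<in>S. nbhd {?c s} {} \<inter> tight_filters S)"
  have cid: "?c s \<in> idems S" if "s \<in> S" for s using idems_conj that assms(3) by blast
  have U_iff: "\<eta> \<in> U \<longleftrightarrow> \<eta> \<in> tight_filters S \<and> (\<exists>s\<in>S. ?c s \<in> \<eta>)" for \<eta>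
    unfolding U_def nbhd_def using tight_filter by auto
  \<comment> \<open>A finite family that fails to cover leaves a nonzero \<open>g\<close> below
    \<open>e\<close> disjoint from all its members, and an ultrafilter through \<open>g\<close>
    avoids the family.\<close>
  have "\<exists>\<eta>\<in>ultrafilters S. e \<in> \<eta> \<and> Z \<inter> \<eta> = {}" if Z: "finite Z" "Z \<subseteq> ?c ` S" for Z
  proof -
    obtain F where F: "F \<subseteq> S" "finite F" "Z = ?c ` F" using finite_subset_image[OF Z] by blast
    then have "\<not> outer_cover S e Z" using none by blast
    moreover have "Z \<subseteq> idems S" using F cid by auto
    ultimately obtain g where g: "g \<in> idems S" "g \<noteq> {}" "g \<subseteq> e" "\<forall>z\<in>Z. z \<inter> g = {}"
      unfolding outer_cover_iff[OF assms(2)] by blast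
    obtain \<xi> where \<xi>: "\<xi> \<in> ultrafilters S" "g \<in> \<xi>" using ultrafilter_containing[OF g(1,2)] by blast
    note \<xi>F = ultrafilter_filter[OF \<xi>(1)]
    have "z \<notin> \<xi>" if "z \<in> Z" for z
      using filter_nonempty[OF \<xi>F filter_Int[OF \<xi>F _ \<xi>(2)], of z] g(4) that by auto
    then show ?thesis using \<xi> filter_up[OF \<xi>F \<xi>(2) assms(2) g(3)] by blast
  qed
  from tight_avoiding[of "?c ` S" e, OF this] obtain \<eta> where
    \<eta>: "\<eta> \<in> tight_filters S" "?c ` S \<inter> \<eta> = {}" by blast
  have "openin (tight_topology S) U" unfolding U_def
    by (intro openin_Union ballI, clarify, rule openin_tight_topology_nbhd, rule nbhdsI) (use cid in auto)
  moreover have "invariant_set (tight_groupoid S) U" unfolding invariant_iff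
  proof (intro conjI ballI impI)
    show "U \<subseteq> tight_filters S" using U_iff by blast
    fix t \<zeta> assume t: "t \<in> S" and \<zeta>: "\<zeta> \<in> U" and tt: "t\<inverse> \<odot> t \<in> \<zeta>"
    obtain s where s: "s \<in> S" "?c s \<in> \<zeta>" and \<zeta>t: "\<zeta> \<in> tight_filters S" using \<zeta> U_iff by blast
    have ts: "t \<odot> s \<in> S" using mult_closed t s(1) by blast
    \<comment> \<open>Invariance: acting by \<open>t\<close> turns the conjugate by \<open>s\<close>
      into the conjugate by \<open>t \<odot> s\<close>.\<close>
    have "t \<odot> ?c s \<odot> t\<inverse> = ?c (t \<odot> s)" by (simp add: converse_relcomp O_assoc)
    then have "?c (t \<odot> s) \<in> act S t \<zeta>"
      unfolding act_iff[OF t tight_filter[OF \<zeta>t]]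
      by (intro conjI bexI[OF _ s(2)] cid[OF ts] equalityD1)
    with ts have "\<exists>s\<in>S. ?c s \<in> act S t \<zeta>" by (intro bexI[of _ "t \<odot> s"])
    then show "act S t \<zeta> \<in> U" unfolding U_iff using act_tight[OF t \<zeta>t tt] by blast
  qed
  moreover have "U \<noteq> {}"
  proof -
    obtain \<xi> where \<xi>: "\<xi> \<in> ultrafilters S" "f \<in> \<xi>" using ultrafilter_containing[OF assms(3,5)] by blast
    \<comment> \<open>The idempotent \<open>f\<close> is its own conjugate by \<open>f\<close>, so
      any ultrafilter through \<open>f\<close> lies in \<open>U\<close>.\<close>
    have "f \<in> S" "f \<odot> f = f" using assms(3) unfolding idems_def by simp_all
    moreover have "f\<inverse> = f" using idem_Id[OF assms(3)] by blast
    ultimately have "\<exists>s\<in>S. ?c s \<in> \<xi>" using \<xi>(2) by (intro bexI[of _ f]) simp_all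
    then have "\<xi> \<in> U" unfolding U_iff using ultrafilter_tight[OF \<xi>(1)] by blast
    then show ?thesis by blast
  qed
  ultimately have "U = tight_filters S" using assms(1) unfolding minimal_iff_invariant by blast
  then show False using \<eta> U_iff by blast
qed

text \<open>Since \<open>Z\<close> is finite, containing \<open>e\<close> and avoiding
  \<open>Z\<close> is an open condition. If \<open>\<eta>\<close> satisfied it, so would some
  ultrafilter, which then contains a nonzero idempotent below \<open>e\<close> disjoint from every
  element of \<open>Z\<close>.\<close>

lemma tight_outer_cover:
  assumes "\<eta> \<in> tight_filters S" "e \<in> \<eta>" "outer_cover S e Z" "finite Z"
  shows "Z \<inter> \<eta> \<noteq> {}"
proof
  assume Z: "Z \<inter> \<eta> = {}"
  have \<eta>: "\<eta> \<in> filters S" using assms(1) by (rule tight_filter)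
  have e: "e \<in> idems S" using filter_idems[OF \<eta> assms(2)] .
  note cov = assms(3)[unfolded outer_cover_iff[OF e]]
  have "nbhd {e} Z \<in> nbhds" using e cov assms(4) by (intro nbhdsI) auto
  moreover have "\<eta> \<in> nbhd {e} Z" using \<eta> Z assms(2) by (intro nbhdI) auto
  ultimately obtain \<xi> where \<xi>: "\<xi> \<in> ultrafilters S" "\<xi> \<in> nbhd {e} Z"
    using assms(1) unfolding tight_iff by blast
  have "{e} \<subseteq> \<xi>" "Z \<inter> \<xi> = {}" using nbhdD[OF \<xi>(2)] by auto
  then obtain g where g: "g \<in> \<xi>" "\<forall>x\<in>{e}. g \<subseteq> x" "\<forall>y\<in>Z. g \<inter> y = {}"
    using ultrafilter_nbhd[OF \<xi>(1), of "{e}" Z] cov assms(4) by auto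
  have "g \<in> idems S" "g \<noteq> {}"
    using filter_idems[OF ultrafilter_filter[OF \<xi>(1)] g(1)] filter_nonempty[OF ultrafilter_filter[OF \<xi>(1)] g(1)] .
  then obtain z where "z \<in> Z" "z \<inter> g \<noteq> {}" using cov g(2) by blast
  then show False using g(3) by blast
qed

lemma outer_cover_imp_minimal:
  assumes "\<And>e f. e \<in> idems S \<Longrightarrow> f \<in> idems S \<Longrightarrow> e \<noteq> {} \<Longrightarrow> f \<noteq> {} \<Longrightarrow>
    \<exists>F\<subseteq>S. finite F \<and> outer_cover S e ((\<lambda>s. s \<odot> f \<odot> s\<inverse>) ` F)"
  shows "minimal_groupoid (tight_groupoid S)"
  unfolding minimal_iff_invariant
proof (intro allI impI)
  fix U assume "openin (tight_topology S) U \<and> invariant_set (tight_groupoid S) U"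
  then have U: "openin (tight_topology S) U" "U \<subseteq> tight_filters S"
    and inv: "\<And>s \<eta>. s \<in> S \<Longrightarrow> \<eta> \<in> U \<Longrightarrow> s\<inverse> \<odot> s \<in> \<eta> \<Longrightarrow> act S s \<eta> \<in> U"
    unfolding invariant_iff by blast+
  show "U = {} \<or> U = tight_filters S"
  proof (rule disjCI)
    assume "U \<noteq> tight_filters S"
    show "U = {}"
    proof (rule ccontr)
      assume "U \<noteq> {}"
      then obtain \<eta>0 where \<eta>0: "\<eta>0 \<in> U" by blast
      obtain N where N: "N \<in> nbhds" "\<eta>0 \<in> N" "N \<inter> tight_filters S \<subseteq> U"
        using openin_tight_topologyD[OF U(1) \<eta>0] by blast
      have "\<eta>0 \<in> tight_filters S" using \<eta>0 U(2) by blast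
      \<comment> \<open>Density of ultrafilters replaces \<open>\<eta>0\<close> by an ultrafilter,
        to which \<open>ultrafilter_nbhd\<close> applies.\<close>
      then obtain \<xi> where \<xi>: "\<xi> \<in> ultrafilters S" "\<xi> \<in> N" using N unfolding tight_iff by blast
      obtain X Y where XY: "N = nbhd X Y" "finite X" "X \<subseteq> idems S" "finite Y" "Y \<subseteq> idems S"
        using N(1) by (rule nbhdsE)
      have \<xi>N: "\<xi> \<in> nbhd X Y" using \<xi>(2) XY(1) by simp
      obtain f where f: "f \<in> \<xi>" "\<forall>x\<in>X. f \<subseteq> x" "\<forall>y\<in>Y. f \<inter> y = {}"
        using ultrafilter_nbhd[OF \<xi>(1) XY(2) nbhdD(2)[OF \<xi>N] XY(4,5) nbhdD(3)[OF \<xi>N]]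
        by (elim bexE conjE) (rule that)
      have fid: "f \<in> idems S" "f \<noteq> {}"
        using filter_idems[OF ultrafilter_filter[OF \<xi>(1)] f(1)] filter_nonempty[OF ultrafilter_filter[OF \<xi>(1)] f(1)] .
      have fU: "\<zeta> \<in> U" if "\<zeta> \<in> tight_filters S" "f \<in> \<zeta>" for \<zeta>
      proof -
        have \<zeta>: "\<zeta> \<in> filters S" using that(1) by (rule tight_filter)
        have "X \<subseteq> \<zeta>" using filter_up[OF \<zeta> that(2)] f(2) XY(3) by auto
        moreover have "Y \<inter> \<zeta> = {}" using filter_nonempty[OF \<zeta> filter_Int[OF \<zeta> that(2)]] f(3) by auto
        ultimately have "\<zeta> \<in> N" unfolding XY(1) by (rule nbhdI[OF \<zeta>])
        then show ?thesis using N(3) that(1) by blast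
      qed
      have "\<eta> \<in> U" if \<eta>t: "\<eta> \<in> tight_filters S" for \<eta>
      proof -
        have \<eta>: "\<eta> \<in> filters S" using \<eta>t by (rule tight_filter)
        obtain e where e: "e \<in> \<eta>" using filter_ex[OF \<eta>] by blast
        obtain F where F: "F \<subseteq> S" "finite F" "outer_cover S e ((\<lambda>s. s \<odot> f \<odot> s\<inverse>) ` F)"
          using assms[OF filter_idems[OF \<eta> e] fid(1) filter_nonempty[OF \<eta> e] fid(2)] by blast
        obtain s where s: "s \<in> F" "s \<odot> f \<odot> s\<inverse> \<in> \<eta>"
          using tight_outer_cover[OF \<eta>t e F(3)] F(2) by auto
        have sS: "s \<in> S" "s\<inverse> \<in> S" using s(1) F(1) star_closed by blast+
        \<comment> \<open>An idempotent below \<open>s \<odot> s\<inverse>\<close> lies in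
          \<open>\<eta>\<close>, so \<open>s\<inverse>\<close> acts on
          \<open>\<eta>\<close>.\<close>
        have "s \<odot> f \<odot> s\<inverse> \<subseteq> s \<odot> s\<inverse>" using idem_Id[OF fid(1)] by blast
        then have ss: "(s\<inverse>)\<inverse> \<odot> s\<inverse> \<in> \<eta>"
          using filter_up[OF \<eta> s(2) mult_star_idems[OF sS(1)]] by simp
        have "f \<in> act S (s\<inverse>) \<eta>" using act_conv[OF sS(2) \<eta> ss] fid(1) s(2) by simp
        then have "act S (s\<inverse>) \<eta> \<in> U" using fU act_tight[OF sS(2) \<eta>t ss] by blast
        moreover have "s\<inverse> \<odot> s \<in> act S (s\<inverse>) \<eta>" using act_filter(2)[OF sS(2) \<eta> ss] by simp
        \<comment> \<open>The image under \<open>s\<inverse>\<close> is in \<open>U\<close>;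
          invariance under \<open>s\<close> brings the original filter \<open>\<eta>\<close> into
          \<open>U\<close>.\<close>
        ultimately have "act S s (act S (s\<inverse>) \<eta>) \<in> U" by (rule inv[OF sS(1)])
        then show ?thesis using act_star_act[OF sS(2) \<eta> ss] by simp
      qed
      then show False using \<open>U \<noteq> tight_filters S\<close> U(2) by blast
    qed
  qed
qed

end

section \<open>The semigroup of a finitely aligned category\<close>

locale finitely_aligned_lcsc = small_category +
  assumes left_canc: "left_cancellative \<Lambda>"
    and fin_align: "finitely_aligned \<Lambda>"
begin

abbreviation src_of ("\<s>") where "\<s> \<equiv> src \<Lambda>"
abbreviation rng_of ("\<r>") where "\<r> \<equiv> rng \<Lambda>"
abbreviation comp_of (infixl "\<cdot>" 70) where "\<alpha> \<cdot> \<beta> \<equiv> cmp \<Lambda> \<alpha> \<beta>"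

section \<open>Right ideals and common right multiples\<close>

lemma cancel:
  assumes "\<alpha> \<cdot> \<beta> = \<alpha> \<cdot> \<gamma>" "\<alpha> \<in> mor \<Lambda>" "\<beta> \<in> mor \<Lambda>" "\<gamma> \<in> mor \<Lambda>" "\<s> \<alpha> = \<r> \<beta>" "\<s> \<alpha> = \<r> \<gamma>"
  shows "\<beta> = \<gamma>"
  using left_canc assms unfolding left_cancellative_def by simp

lemma right_idealI: "\<beta> \<in> mor \<Lambda> \<Longrightarrow> \<r> \<beta> = \<s> \<alpha> \<Longrightarrow> \<alpha> \<cdot> \<beta> \<in> right_ideal \<Lambda> \<alpha>"
  unfolding right_ideal_def by blast

lemma right_idealE:
  assumes "x \<in> right_ideal \<Lambda> \<alpha>"
  obtains \<beta> where "x = \<alpha> \<cdot> \<beta>" "\<beta> \<in> mor \<Lambda>" "\<r> \<beta> = \<s> \<alpha>"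
  using assms unfolding right_ideal_def by blast

lemma right_ideal_self: "\<alpha> \<in> mor \<Lambda> \<Longrightarrow> \<alpha> \<in> right_ideal \<Lambda> \<alpha>"
  using right_idealI[OF src_mor rng_src] cmp_src by fastforce

lemma right_idealD:
  assumes "x \<in> right_ideal \<Lambda> \<alpha>" "\<alpha> \<in> mor \<Lambda>"
  shows "x \<in> mor \<Lambda>" "\<r> x = \<r> \<alpha>"
  using assms(1) by (rule right_idealE, simp add: assms(2) cmp_mor rng_cmp)+

lemma right_ideal_trans:
  assumes "y \<in> right_ideal \<Lambda> x" "x \<in> right_ideal \<Lambda> \<alpha>" "\<alpha> \<in> mor \<Lambda>"
  shows "y \<in> right_ideal \<Lambda> \<alpha>"
proof -
  obtain \<beta> where \<beta>: "x = \<alpha> \<cdot> \<beta>" "\<beta> \<in> mor \<Lambda>" "\<r> \<beta> = \<s> \<alpha>" using assms(2) by (rule right_idealE)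
  obtain \<gamma> where \<gamma>: "y = x \<cdot> \<gamma>" "\<gamma> \<in> mor \<Lambda>" "\<r> \<gamma> = \<s> x" using assms(1) by (rule right_idealE)
  have "\<s> \<beta> = \<r> \<gamma>" using \<gamma>(3) \<beta> assms(3) by (simp add: src_cmp)
  then have "y = \<alpha> \<cdot> (\<beta> \<cdot> \<gamma>)" "\<beta> \<cdot> \<gamma> \<in> mor \<Lambda>" "\<r> (\<beta> \<cdot> \<gamma>) = \<s> \<alpha>"
    using \<beta> \<gamma> assms(3) by (simp_all add: cmp_assoc cmp_mor rng_cmp)
  then show ?thesis using right_idealI by simp
qed

lemma right_ideal_object:
  assumes "v \<in> mor \<Lambda>" "\<s> v = v"
  shows "x \<in> right_ideal \<Lambda> v \<longleftrightarrow> x \<in> mor \<Lambda> \<and> \<r> x = v"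
proof
  assume "x \<in> right_ideal \<Lambda> v"
  then obtain \<beta> where \<beta>: "x = v \<cdot> \<beta>" "\<beta> \<in> mor \<Lambda>" "\<r> \<beta> = \<s> v" by (rule right_idealE)
  then have "x = \<beta>" using assms(2) cmp_rng[OF \<beta>(2)] by simp
  then show "x \<in> mor \<Lambda> \<and> \<r> x = v" using \<beta> assms(2) by simp
next
  assume x: "x \<in> mor \<Lambda> \<and> \<r> x = v"
  then have "v \<cdot> x \<in> right_ideal \<Lambda> v" using assms(2) by (intro right_idealI) auto
  then show "x \<in> right_ideal \<Lambda> v" using x cmp_rng by metis
qed

lemma tau_iff:
  assumes "\<alpha> \<in> mor \<Lambda>"
  shows "(\<beta>, \<gamma>) \<in> tau \<Lambda> \<alpha> \<longleftrightarrow> \<beta> \<in> mor \<Lambda> \<and> \<r> \<beta> = \<s> \<alpha> \<and> \<gamma> = \<alpha> \<cdot> \<beta>"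
  unfolding tau_def using right_ideal_object[OF src_mor[OF assms] src_src[OF assms]] by auto

text \<open>A finite description of all common right multiples of \<open>y\<close> and
  \<open>y'\<close>. It records pairs of complements instead of the multiples, so that equations
  \<open>y \<cdot> z = y' \<cdot> z'\<close> can be solved for both unknowns simultaneously.\<close>

definition multiples_basis :: "'a \<Rightarrow> 'a \<Rightarrow> ('a \<times> 'a) set \<Rightarrow> bool" where
  "multiples_basis y y' P \<longleftrightarrow> finite P \<and>
    (\<forall>(p, q)\<in>P. p \<in> mor \<Lambda> \<and> q \<in> mor \<Lambda> \<and> \<r> p = \<s> y \<and> \<r> q = \<s> y' \<and> y \<cdot> p = y' \<cdot> q) \<and>
    (\<forall>z\<in>mor \<Lambda>. \<forall>z'\<in>mor \<Lambda>. \<r> z = \<s> y \<longrightarrow> \<r> z' = \<s> y' \<longrightarrow> y \<cdot> z = y' \<cdot> z' \<longrightarrow>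
       (\<exists>(p, q)\<in>P. \<exists>u\<in>mor \<Lambda>. \<r> u = \<s> p \<and> z = p \<cdot> u \<and> z' = q \<cdot> u))"

text \<open>Factor each generator from finite alignment through \<open>y\<close> and through
  \<open>y'\<close>. A common multiple is a generator times some \<open>u\<close>, and left
  cancellation of \<open>y\<close> and of \<open>y'\<close> shows that the same \<open>u\<close>
  works for both complements.\<close>

lemma multiples_basis_exists:
  assumes y: "y \<in> mor \<Lambda>" "y' \<in> mor \<Lambda>"
  shows "\<exists>P. multiples_basis y y' P"
proof -
  obtain \<Gamma> where \<Gamma>: "\<Gamma> \<subseteq> mor \<Lambda>" "finite \<Gamma>"
    "right_ideal \<Lambda> y \<inter> right_ideal \<Lambda> y' = (\<Union>\<gamma>\<in>\<Gamma>. right_ideal \<Lambda> \<gamma>)"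
    using fin_align y unfolding finitely_aligned_def by metis
  have "\<exists>p q. p \<in> mor \<Lambda> \<and> q \<in> mor \<Lambda> \<and> \<r> p = \<s> y \<and> \<r> q = \<s> y' \<and> \<gamma> = y \<cdot> p \<and> \<gamma> = y' \<cdot> q"
    if "\<gamma> \<in> \<Gamma>" for \<gamma>
  proof -
    have "\<gamma> \<in> right_ideal \<Lambda> \<gamma>" using right_ideal_self that \<Gamma>(1) by blast
    then have "\<gamma> \<in> right_ideal \<Lambda> y" "\<gamma> \<in> right_ideal \<Lambda> y'" using \<Gamma>(3) that by auto
    then show ?thesis by (metis right_idealE)
  qed
  then obtain p q where pq: "\<And>\<gamma>. \<gamma> \<in> \<Gamma> \<Longrightarrow> p \<gamma> \<in> mor \<Lambda> \<and> q \<gamma> \<in> mor \<Lambda> \<and> \<r> (p \<gamma>) = \<s> y \<and> \<r> (q \<gamma>) = \<s> y' \<and>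
      \<gamma> = y \<cdot> p \<gamma> \<and> \<gamma> = y' \<cdot> q \<gamma>" by metis
  let ?P = "(\<lambda>\<gamma>. (p \<gamma>, q \<gamma>)) ` \<Gamma>"
  have "\<exists>(p, q)\<in>?P. \<exists>u\<in>mor \<Lambda>. \<r> u = \<s> p \<and> z = p \<cdot> u \<and> z' = q \<cdot> u"
    if z: "z \<in> mor \<Lambda>" "z' \<in> mor \<Lambda>" "\<r> z = \<s> y" "\<r> z' = \<s> y'" "y \<cdot> z = y' \<cdot> z'" for z z'
  proof -
    have "y \<cdot> z \<in> right_ideal \<Lambda> y \<inter> right_ideal \<Lambda> y'"
      using right_idealI[OF z(1,3)] right_idealI[OF z(2,4)] z(5) by simp
    then obtain \<gamma> where \<gamma>: "\<gamma> \<in> \<Gamma>" "y \<cdot> z \<in> right_ideal \<Lambda> \<gamma>" using \<Gamma>(3) by blast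
    obtain u where u: "y \<cdot> z = \<gamma> \<cdot> u" "u \<in> mor \<Lambda>" "\<r> u = \<s> \<gamma>" using \<gamma>(2) by (rule right_idealE)
    note h = pq[OF \<gamma>(1)]
    have sp: "\<s> \<gamma> = \<s> (p \<gamma>)" "\<s> \<gamma> = \<s> (q \<gamma>)" using h y src_cmp by metis+
    have "y \<cdot> z = y \<cdot> (p \<gamma> \<cdot> u)" using u h y sp cmp_assoc[of y "p \<gamma>" u] by simp
    then have "z = p \<gamma> \<cdot> u" by (rule cancel) (use u h y sp z in \<open>simp_all add: cmp_mor rng_cmp\<close>)
    moreover have "y' \<cdot> z' = y' \<cdot> (q \<gamma> \<cdot> u)" using u h y sp z(5) cmp_assoc[of y' "q \<gamma>" u] by simp
    then have "z' = q \<gamma> \<cdot> u" by (rule cancel) (use u h y sp z in \<open>simp_all add: cmp_mor rng_cmp\<close>)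
    ultimately have "\<exists>u\<in>mor \<Lambda>. \<r> u = \<s> (p \<gamma>) \<and> z = p \<gamma> \<cdot> u \<and> z' = q \<gamma> \<cdot> u" using u sp by metis
    then show ?thesis using \<gamma>(1) by blast
  qed
  moreover have "\<forall>(p, q)\<in>?P. p \<in> mor \<Lambda> \<and> q \<in> mor \<Lambda> \<and> \<r> p = \<s> y \<and> \<r> q = \<s> y' \<and> y \<cdot> p = y' \<cdot> q"
    using pq by auto
  ultimately have "multiples_basis y y' ?P" unfolding multiples_basis_def using \<Gamma>(2) by blast
  then show ?thesis ..
qed

section \<open>Partial maps generated by finitely many pairs under right multiplication\<close>

definition translates :: "('a \<times> 'a) set \<Rightarrow> 'a pmap" where
  "translates A = {(x \<cdot> z, y \<cdot> z) | x y z. (x, y) \<in> A \<and> z \<in> mor \<Lambda> \<and> \<r> z = \<s> x}"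

text \<open>For \<open>A \<subseteq> parallel\<close>, \<open>translates A\<close> is the union of
  the maps \<open>tau \<Lambda> y \<odot> sigma \<Lambda> x\<close> over the pairs
  \<open>(x, y)\<close> in \<open>A\<close>.\<close>

definition parallel :: "('a \<times> 'a) set" where
  "parallel = {(x, y). x \<in> mor \<Lambda> \<and> y \<in> mor \<Lambda> \<and> \<s> x = \<s> y}"

lemma translatesI:
  "(x, y) \<in> A \<Longrightarrow> z \<in> mor \<Lambda> \<Longrightarrow> \<r> z = \<s> x \<Longrightarrow> a = x \<cdot> z \<Longrightarrow> b = y \<cdot> z \<Longrightarrow> (a, b) \<in> translates A"
  unfolding translates_def by blast

lemma translatesE:
  assumes "(a, b) \<in> translates A"
  obtains x y z where "(x, y) \<in> A" "z \<in> mor \<Lambda>" "\<r> z = \<s> x" "a = x \<cdot> z" "b = y \<cdot> z"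
  using assms unfolding translates_def by blast

lemma parallelD: "(x, y) \<in> parallel \<Longrightarrow> x \<in> mor \<Lambda> \<and> y \<in> mor \<Lambda> \<and> \<s> x = \<s> y"
  unfolding parallel_def by blast

lemma translates_generators:
  assumes "A \<subseteq> parallel" shows "A \<subseteq> translates A"
proof (rule subrelI)
  fix x y assume xy: "(x, y) \<in> A"
  then have p: "x \<in> mor \<Lambda>" "y \<in> mor \<Lambda>" "\<s> x = \<s> y" using assms parallelD by blast+
  show "(x, y) \<in> translates A"
    using translatesI[OF xy src_mor[OF p(1)] rng_src[OF p(1)] refl refl] cmp_src[OF p(1)] cmp_src[OF p(2)] p(3)
    by simp
qed

lemma translates_right_closed:
  assumes "A \<subseteq> parallel" "(a, b) \<in> translates A" "z \<in> mor \<Lambda>" "\<r> z = \<s> a"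
  shows "(a \<cdot> z, b \<cdot> z) \<in> translates A"
proof -
  obtain x y u where u: "(x, y) \<in> A" "u \<in> mor \<Lambda>" "\<r> u = \<s> x" "a = x \<cdot> u" "b = y \<cdot> u"
    using assms(2) by (rule translatesE)
  then have p: "x \<in> mor \<Lambda>" "y \<in> mor \<Lambda>" "\<s> x = \<s> y" using assms(1) parallelD by blast+
  have z: "\<r> z = \<s> u" using assms(4) u p by (simp add: src_cmp)
  show ?thesis
    by (rule translatesI[OF u(1), of "u \<cdot> z"])
      (use u p z assms(3) in \<open>simp_all add: cmp_assoc cmp_mor rng_cmp\<close>)
qed

lemma translates_parallel:
  assumes "A \<subseteq> parallel" shows "translates A \<subseteq> parallel"
proof (rule subrelI)
  fix a b assume "(a, b) \<in> translates A"
  then obtain x y u where u: "(x, y) \<in> A" "u \<in> mor \<Lambda>" "\<r> u = \<s> x" "a = x \<cdot> u" "b = y \<cdot> u"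
    by (rule translatesE)
  then have "x \<in> mor \<Lambda>" "y \<in> mor \<Lambda>" "\<s> x = \<s> y" using assms parallelD by blast+
  then show "(a, b) \<in> parallel" using u unfolding parallel_def by (simp add: cmp_mor src_cmp)
qed

text \<open>The condition on \<open>z\<close> mentions only the source of the first component;
  equality of the two sources makes it symmetric.\<close>

lemma translates_converse:
  assumes "A \<subseteq> parallel" shows "(translates A)\<inverse> = translates (A\<inverse>)"
proof -
  have "\<s> x = \<s> y" if "(x, y) \<in> A" for x y using that assms parallelD by blast
  then show ?thesis unfolding translates_def by fastforce
qed

lemma parallel_converse: "A \<subseteq> parallel \<Longrightarrow> A\<inverse> \<subseteq> parallel"
  unfolding parallel_def by auto

text \<open>Composing \<open>x \<cdot> z \<mapsto> y \<cdot> z\<close> with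
  \<open>y' \<cdot> z' \<mapsto> w \<cdot> z'\<close> requires
  \<open>y \<cdot> z = y' \<cdot> z'\<close>. The solutions are \<open>z = p \<cdot> u\<close>,
  \<open>z' = q \<cdot> u\<close> with \<open>(p, q)\<close> in a multiples basis, so the composite
  is generated by the pairs \<open>(x \<cdot> p, w \<cdot> q)\<close>.\<close>

lemma translates_relcomp:
  assumes A: "finite A" "A \<subseteq> parallel" and B: "finite B" "B \<subseteq> parallel"
  shows "\<exists>C\<subseteq>parallel. finite C \<and> translates B O translates A = translates C"
proof -
  obtain P where basis: "\<And>y y'. y \<in> mor \<Lambda> \<Longrightarrow> y' \<in> mor \<Lambda> \<Longrightarrow> multiples_basis y y' (P y y')"
    using multiples_basis_exists by metis
  note P = basis[unfolded multiples_basis_def]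
  let ?D = "\<lambda>b a. (\<lambda>(p, q). (fst b \<cdot> p, snd a \<cdot> q)) ` P (snd b) (fst a)"
  let ?C = "\<Union>b\<in>B. \<Union>a\<in>A. ?D b a"
  have Bp: "x \<in> mor \<Lambda>" "y \<in> mor \<Lambda>" "\<s> x = \<s> y" if "(x, y) \<in> B" for x y
    using that B(2) parallelD by blast+
  have Ap: "x \<in> mor \<Lambda>" "y \<in> mor \<Lambda>" "\<s> x = \<s> y" if "(x, y) \<in> A" for x y
    using that A(2) parallelD by blast+
  have C_I: "(x \<cdot> p, w \<cdot> q) \<in> ?C" if "(x, y) \<in> B" "(y', w) \<in> A" "(p, q) \<in> P y y'" for x y y' w p q
    using that by force
  have C_E: "\<exists>x y y' w p q. (x, y) \<in> B \<and> (y', w) \<in> A \<and> (p, q) \<in> P y y' \<and> a = x \<cdot> p \<and> b = w \<cdot> q"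
    if "(a, b) \<in> ?C" for a b
    using that by fastforce
  have PD: "p \<in> mor \<Lambda>" "q \<in> mor \<Lambda>" "\<r> p = \<s> y" "\<r> q = \<s> y'" "y \<cdot> p = y' \<cdot> q" "\<s> p = \<s> q"
    if "(p, q) \<in> P y y'" "y \<in> mor \<Lambda>" "y' \<in> mor \<Lambda>" for p q y y'
  proof -
    show h: "p \<in> mor \<Lambda>" "q \<in> mor \<Lambda>" "\<r> p = \<s> y" "\<r> q = \<s> y'" "y \<cdot> p = y' \<cdot> q"
      using P[OF that(2,3)] that(1) by blast+
    show "\<s> p = \<s> q" using h that(2,3) src_cmp by metis
  qed
  have "finite ?C"
  proof (intro finite_UN_I A(1) B(1) finite_imageI)
    fix b a assume "b \<in> B" "a \<in> A"
    then have "snd b \<in> mor \<Lambda>" "fst a \<in> mor \<Lambda>" using Bp(2)[of "fst b" "snd b"] Ap(1)[of "fst a" "snd a"] by auto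
    then show "finite (P (snd b) (fst a))" using P by blast
  qed
  moreover have "?C \<subseteq> parallel"
  proof (rule subrelI)
    fix a b assume "(a, b) \<in> ?C"
    then obtain x y y' w p q where h: "(x, y) \<in> B" "(y', w) \<in> A" "(p, q) \<in> P y y'" "a = x \<cdot> p" "b = w \<cdot> q"
      using C_E by blast
    note pd = PD[OF h(3) Bp(2)[OF h(1)] Ap(1)[OF h(2)]]
    show "(a, b) \<in> parallel"
      unfolding parallel_def h(4,5) using pd Bp[OF h(1)] Ap[OF h(2)] by (simp add: cmp_mor src_cmp)
  qed
  moreover have "translates B O translates A = translates ?C"
  proof (intro equalityI subrelI)
    fix a c assume "(a, c) \<in> translates B O translates A"
    then obtain b where "(a, b) \<in> translates B" "(b, c) \<in> translates A" by blast
    then obtain x y z y' w z' where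
      h: "(x, y) \<in> B" "z \<in> mor \<Lambda>" "\<r> z = \<s> x" "a = x \<cdot> z" "b = y \<cdot> z"
         "(y', w) \<in> A" "z' \<in> mor \<Lambda>" "\<r> z' = \<s> y'" "b = y' \<cdot> z'" "c = w \<cdot> z'"
      by (elim translatesE)
    note b = Bp[OF h(1)] and a = Ap[OF h(6)]
    have "\<r> z = \<s> y" "y \<cdot> z = y' \<cdot> z'" using h b by simp_all
    then obtain p q u where u: "(p, q) \<in> P y y'" "u \<in> mor \<Lambda>" "\<r> u = \<s> p" "z = p \<cdot> u" "z' = q \<cdot> u"
      using P[OF b(2) a(1)] h(2,7,8) by blast
    note pd = PD[OF u(1) b(2) a(1)]
    show "(a, c) \<in> translates ?C"
      by (rule translatesI[OF C_I[OF h(1,6) u(1)] u(2)])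
        (use h a b u pd in \<open>simp_all add: src_cmp cmp_assoc\<close>)
  next
    fix a c assume "(a, c) \<in> translates ?C"
    then obtain a' c' u where u: "(a', c') \<in> ?C" "u \<in> mor \<Lambda>" "\<r> u = \<s> a'" "a = a' \<cdot> u" "c = c' \<cdot> u"
      by (rule translatesE)
    then obtain x y y' w p q where h: "(x, y) \<in> B" "(y', w) \<in> A" "(p, q) \<in> P y y'" "a' = x \<cdot> p" "c' = w \<cdot> q"
      using C_E by blast
    note b = Bp[OF h(1)] and a = Ap[OF h(2)]
    note pd = PD[OF h(3) b(2) a(1)]
    have ru: "\<r> u = \<s> p" using u(3) h(4) pd b by (simp add: src_cmp)
    have "(a, y \<cdot> (p \<cdot> u)) \<in> translates B"
      by (rule translatesI[OF h(1)]) (use u h a b pd ru in \<open>simp_all add: cmp_assoc cmp_mor rng_cmp\<close>)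
    moreover have "y \<cdot> (p \<cdot> u) = y' \<cdot> (q \<cdot> u)"
      using cmp_assoc[of y p u] cmp_assoc[of y' q u] u a b pd ru by simp
    moreover have "(y' \<cdot> (q \<cdot> u), c) \<in> translates A"
      by (rule translatesI[OF h(2)]) (use u h a b pd ru in \<open>simp_all add: cmp_assoc cmp_mor rng_cmp\<close>)
    ultimately show "(a, c) \<in> translates B O translates A" by auto
  qed
  ultimately show ?thesis by blast
qed

lemma tau_translates:
  assumes "\<alpha> \<in> mor \<Lambda>"
  shows "tau \<Lambda> \<alpha> = translates {(\<s> \<alpha>, \<alpha>)}" "{(\<s> \<alpha>, \<alpha>)} \<subseteq> parallel"
proof -
  have "\<s> \<alpha> \<cdot> z = z" if "z \<in> mor \<Lambda>" "\<r> z = \<s> \<alpha>" for z using that cmp_rng by metis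
  then have "(\<beta>, \<gamma>) \<in> tau \<Lambda> \<alpha> \<longleftrightarrow> (\<beta>, \<gamma>) \<in> translates {(\<s> \<alpha>, \<alpha>)}" for \<beta> \<gamma>
    unfolding tau_iff[OF assms] translates_def using src_src[OF assms] by force
  then show "tau \<Lambda> \<alpha> = translates {(\<s> \<alpha>, \<alpha>)}" by auto
  show "{(\<s> \<alpha>, \<alpha>)} \<subseteq> parallel" unfolding parallel_def by (simp add: assms src_mor src_src)
qed

text \<open>Structure of the semigroup: the generators come from single pairs, inverses swap the
  pairs, and products stay finitely generated by \<open>translates_relcomp\<close>, which rests on
  finite alignment.\<close>

lemma cat_semigroup_translates:
  assumes "s \<in> cat_semigroup \<Lambda>"
  shows "\<exists>A\<subseteq>parallel. finite A \<and> s = translates A"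
  using assms
proof induction
  case (tau \<alpha>)
  then show ?case by (intro exI[of _ "{(\<s> \<alpha>, \<alpha>)}"]) (use tau_translates in simp)
next
  case (sigma \<alpha>)
  note t = tau_translates[OF sigma]
  show ?case unfolding sigma_def t(1) translates_converse[OF t(2)]
    using parallel_converse[OF t(2)] by (intro exI[of _ "{(\<s> \<alpha>, \<alpha>)}\<inverse>"]) simp
next
  case (star s)
  then obtain A where "A \<subseteq> parallel" "finite A" "s = translates A" by blast
  then show ?case by (intro exI[of _ "A\<inverse>"]) (simp add: translates_converse parallel_converse)
next
  case (mult s t)
  then show ?case using translates_relcomp by metis
qed

section \<open>Consequences for semigroup elements and idempotents\<close>

lemma semigroup_parallel: "s \<in> cat_semigroup \<Lambda> \<Longrightarrow> s \<subseteq> parallel"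
  using cat_semigroup_translates[of s] translates_parallel by blast

lemma semigroup_right_closed:
  assumes "s \<in> cat_semigroup \<Lambda>" "(a, b) \<in> s" "z \<in> mor \<Lambda>" "\<r> z = \<s> a"
  shows "(a \<cdot> z, b \<cdot> z) \<in> s"
proof -
  obtain A where A: "A \<subseteq> parallel" "s = translates A" using cat_semigroup_translates[OF assms(1)] by blast
  show ?thesis using translates_right_closed[OF A(1) assms(2)[unfolded A(2)] assms(3,4)] A(2) by simp
qed

sublocale pbij_semigroup "cat_semigroup \<Lambda>"
  by (rule pbij_cat_semigroup[OF small_category_axioms left_canc])

text \<open>The generating pairs belong to \<open>e\<close> themselves, hence are diagonal, and a
  diagonal pair \<open>(x, x)\<close> generates the identity on the right ideal of
  \<open>x\<close>.\<close>

lemma idem_right_ideals: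
  assumes "e \<in> idems (cat_semigroup \<Lambda>)"
  shows "\<exists>G\<subseteq>mor \<Lambda>. finite G \<and> e = Id_on (\<Union>\<gamma>\<in>G. right_ideal \<Lambda> \<gamma>)"
proof -
  have e: "e \<in> cat_semigroup \<Lambda>" "e \<subseteq> Id" using assms idems_iff by blast+
  obtain A where A: "A \<subseteq> parallel" "finite A" "e = translates A" using cat_semigroup_translates[OF e(1)] by blast
  have "A \<subseteq> Id" using translates_generators[OF A(1)] A(3) e(2) by blast
  then have eq: "y = x" if "(x, y) \<in> A" for x y using that by blast
  have "e = Id_on (\<Union>\<gamma>\<in>fst ` A. right_ideal \<Lambda> \<gamma>)"
  proof (intro equalityI subrelI)
    fix a b assume "(a, b) \<in> e"
    then obtain x y z where z: "(x, y) \<in> A" "z \<in> mor \<Lambda>" "\<r> z = \<s> x" "a = x \<cdot> z" "b = y \<cdot> z"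
      unfolding A(3) by (rule translatesE)
    then have "b = a" "a \<in> right_ideal \<Lambda> x" using eq right_idealI by auto
    moreover have "x \<in> fst ` A" using z(1) by force
    ultimately show "(a, b) \<in> Id_on (\<Union>\<gamma>\<in>fst ` A. right_ideal \<Lambda> \<gamma>)" by auto
  next
    fix a b assume "(a, b) \<in> Id_on (\<Union>\<gamma>\<in>fst ` A. right_ideal \<Lambda> \<gamma>)"
    then obtain x where x: "x \<in> fst ` A" "a \<in> right_ideal \<Lambda> x" "b = a" by auto
    then have xA: "(x, x) \<in> A" using eq by force
    obtain z where "a = x \<cdot> z" "z \<in> mor \<Lambda>" "\<r> z = \<s> x" using x(2) by (rule right_idealE)
    then show "(a, b) \<in> e" unfolding A(3) x(3) using translatesI[OF xA] by simp
  qed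
  moreover have "fst ` A \<subseteq> mor \<Lambda>" using A(1) parallelD by force
  ultimately show ?thesis using A(2) by blast
qed

text \<open>This is the range projection of \<open>tau \<Lambda> \<alpha>\<close>, and it contains
  the point \<open>\<alpha>\<close>.\<close>

lemma right_ideal_idem:
  assumes "\<alpha> \<in> mor \<Lambda>"
  shows "Id_on (right_ideal \<Lambda> \<alpha>) \<in> idems (cat_semigroup \<Lambda>)" "Id_on (right_ideal \<Lambda> \<alpha>) \<noteq> {}"
proof -
  have "tau \<Lambda> \<alpha> \<odot> (tau \<Lambda> \<alpha>)\<inverse> = Id_on (right_ideal \<Lambda> \<alpha>)"
  proof (intro equalityI subrelI)
    fix a b assume "(a, b) \<in> tau \<Lambda> \<alpha> \<odot> (tau \<Lambda> \<alpha>)\<inverse>"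
    then show "(a, b) \<in> Id_on (right_ideal \<Lambda> \<alpha>)" using tau_iff[OF assms] right_idealI by auto
  next
    fix a b assume "(a, b) \<in> Id_on (right_ideal \<Lambda> \<alpha>)"
    then obtain \<beta> where "a = \<alpha> \<cdot> \<beta>" "b = \<alpha> \<cdot> \<beta>" "\<beta> \<in> mor \<Lambda>" "\<r> \<beta> = \<s> \<alpha>" by (auto elim: right_idealE)
    then show "(a, b) \<in> tau \<Lambda> \<alpha> \<odot> (tau \<Lambda> \<alpha>)\<inverse>" using tau_iff[OF assms] by auto
  qed
  then show "Id_on (right_ideal \<Lambda> \<alpha>) \<in> idems (cat_semigroup \<Lambda>)"
    using mult_star_idems[OF cat_semigroup.tau[OF assms]] by simp
  show "Id_on (right_ideal \<Lambda> \<alpha>) \<noteq> {}" using right_ideal_self[OF assms] by blast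
qed

lemma outer_cover_imp_FE:
  assumes \<alpha>: "\<alpha> \<in> mor \<Lambda>" and \<beta>: "\<beta> \<in> mor \<Lambda>" and F: "F \<subseteq> cat_semigroup \<Lambda>" "finite F"
    and cov: "outer_cover (cat_semigroup \<Lambda>) (Id_on (right_ideal \<Lambda> \<alpha>))
      ((\<lambda>s. s \<odot> Id_on (right_ideal \<Lambda> \<beta>) \<odot> s\<inverse>) ` F)"
  shows "\<exists>H\<in>FE \<Lambda> \<alpha>. \<forall>\<gamma>\<in>H. homset \<Lambda> (\<s> \<beta>) (\<s> \<gamma>) \<noteq> {}"
proof -
  let ?f = "Id_on (right_ideal \<Lambda> \<beta>)"
  have f: "?f \<in> idems (cat_semigroup \<Lambda>)" using right_ideal_idem[OF \<beta>] by blast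
  have "\<exists>G\<subseteq>mor \<Lambda>. finite G \<and> s \<odot> ?f \<odot> s\<inverse> = Id_on (\<Union>\<gamma>\<in>G. right_ideal \<Lambda> \<gamma>)" if "s \<in> F" for s
    using idem_right_ideals idems_conj[OF _ f] that F(1) by blast
  then obtain G where G: "\<And>s. s \<in> F \<Longrightarrow> G s \<subseteq> mor \<Lambda> \<and> finite (G s) \<and>
      s \<odot> ?f \<odot> s\<inverse> = Id_on (\<Union>\<gamma>\<in>G s. right_ideal \<Lambda> \<gamma>)" by metis
  \<comment> \<open>The conjugates may also involve right ideals with other ranges. These cannot
    meet the right ideal of \<open>\<alpha>\<close>, and sets in
    \<open>FE \<Lambda> \<alpha>\<close> must have range \<open>\<r> \<alpha>\<close>.\<close>
  let ?H = "{\<gamma> \<in> (\<Union>s\<in>F. G s). \<r> \<gamma> = \<r> \<alpha>}"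
  have ro: "x \<in> right_ideal \<Lambda> (\<r> \<alpha>) \<longleftrightarrow> x \<in> mor \<Lambda> \<and> \<r> x = \<r> \<alpha>" for x
    using right_ideal_object[OF rng_mor[OF \<alpha>] src_rng[OF \<alpha>]] .
  have "?H \<in> FE \<Lambda> \<alpha>" unfolding FE_def mem_Collect_eq
  proof (intro conjI ballI)
    show "finite ?H" using G F(2) by auto
    show "?H \<subseteq> right_ideal \<Lambda> (\<r> \<alpha>)" using G ro by blast
    fix \<gamma> assume \<gamma>: "\<gamma> \<in> right_ideal \<Lambda> \<alpha>"
    have \<gamma>m: "\<gamma> \<in> mor \<Lambda>" "\<r> \<gamma> = \<r> \<alpha>" using right_idealD[OF \<gamma> \<alpha>] .
    \<comment> \<open>The covering property is tested on the identity of the smaller right ideal of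
      \<open>\<gamma>\<close>.\<close>
    have "Id_on (right_ideal \<Lambda> \<gamma>) \<subseteq> Id_on (right_ideal \<Lambda> \<alpha>)"
      using right_ideal_trans[OF _ \<gamma> \<alpha>] by blast
    with cov[unfolded outer_cover_iff[OF right_ideal_idem(1)[OF \<alpha>]], THEN conjunct2, THEN bspec,
        OF right_ideal_idem(1)[OF \<gamma>m(1)]] right_ideal_idem(2)[OF \<gamma>m(1)]
    have "\<exists>s\<in>F. (s \<odot> ?f \<odot> s\<inverse>) \<inter> Id_on (right_ideal \<Lambda> \<gamma>) \<noteq> {}" by simp
    then obtain s where s: "s \<in> F" "(s \<odot> ?f \<odot> s\<inverse>) \<inter> Id_on (right_ideal \<Lambda> \<gamma>) \<noteq> {}" ..
    then obtain x \<delta> where x: "\<delta> \<in> G s" "x \<in> right_ideal \<Lambda> \<delta>" "x \<in> right_ideal \<Lambda> \<gamma>" using G[OF s(1)] by auto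
    have "\<delta> \<in> mor \<Lambda>" using G[OF s(1)] x(1) by blast
    then have "\<r> \<delta> = \<r> \<alpha>" using right_idealD(2)[OF x(2)] right_idealD(2)[OF x(3) \<gamma>m(1)] \<gamma>m(2) by simp
    then show "\<exists>\<delta>\<in>?H. meets \<Lambda> \<delta> \<gamma>" unfolding meets_def using x s(1) by blast
  qed
  moreover have "homset \<Lambda> (\<s> \<beta>) (\<s> \<gamma>) \<noteq> {}" if \<gamma>: "\<gamma> \<in> ?H" for \<gamma>
  proof -
    obtain s where s: "s \<in> F" "\<gamma> \<in> G s" using \<gamma> by blast
    have \<gamma>m: "\<gamma> \<in> mor \<Lambda>" using G s by blast
    have "(\<gamma>, \<gamma>) \<in> s \<odot> ?f \<odot> s\<inverse>" using G[OF s(1)] s(2) right_ideal_self[OF \<gamma>m] by auto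
    \<comment> \<open>\<open>\<gamma>\<close> is the image under \<open>s\<close> of some
      \<open>x = \<beta> \<cdot> \<delta>\<close>; because \<open>s\<close> preserves sources,
      \<open>\<delta>\<close> is the required morphism.\<close>
    then obtain x where x: "(x, \<gamma>) \<in> s" "x \<in> right_ideal \<Lambda> \<beta>" by auto
    obtain \<delta> where \<delta>: "x = \<beta> \<cdot> \<delta>" "\<delta> \<in> mor \<Lambda>" "\<r> \<delta> = \<s> \<beta>" using x(2) by (rule right_idealE)
    have "(x, \<gamma>) \<in> parallel" using x(1) semigroup_parallel[of s] s(1) F(1) by blast
    then have "\<s> x = \<s> \<gamma>" using parallelD by blast
    then have "\<s> \<delta> = \<s> \<gamma>" using \<delta> \<beta> by (simp add: src_cmp)
    then show ?thesis unfolding homset_def using \<delta> by blast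
  qed
  ultimately show ?thesis by blast
qed

lemma FE_imp_outer_cover:
  assumes e: "e \<in> idems (cat_semigroup \<Lambda>)" and f: "f \<in> idems (cat_semigroup \<Lambda>)" "f \<noteq> {}"
    and FE: "\<And>\<alpha> \<beta>. \<alpha> \<in> mor \<Lambda> \<Longrightarrow> \<beta> \<in> mor \<Lambda> \<Longrightarrow>
      \<exists>H\<in>FE \<Lambda> \<alpha>. \<forall>\<gamma>\<in>H. homset \<Lambda> (\<s> \<beta>) (\<s> \<gamma>) \<noteq> {}"
  shows "\<exists>F\<subseteq>cat_semigroup \<Lambda>. finite F \<and> outer_cover (cat_semigroup \<Lambda>) e ((\<lambda>s. s \<odot> f \<odot> s\<inverse>) ` F)"
proof -
  obtain G where G: "G \<subseteq> mor \<Lambda>" "finite G" "e = Id_on (\<Union>\<gamma>\<in>G. right_ideal \<Lambda> \<gamma>)"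
    using idem_right_ideals[OF e] by blast
  have fS: "f \<in> cat_semigroup \<Lambda>" "f \<subseteq> Id" using f(1) idems_iff by blast+
  \<comment> \<open>Any point of \<open>f\<close> will do: right closure puts all its right
    multiples into \<open>f\<close>.\<close>
  obtain \<beta> where \<beta>f: "(\<beta>, \<beta>) \<in> f" using f(2) fS(2) by auto
  have \<beta>: "\<beta> \<in> mor \<Lambda>" using \<beta>f semigroup_parallel[OF fS(1)] parallelD by blast
  obtain \<Phi> where \<Phi>: "\<And>\<alpha>. \<alpha> \<in> G \<Longrightarrow> \<Phi> \<alpha> \<in> FE \<Lambda> \<alpha> \<and> (\<forall>\<gamma>\<in>\<Phi> \<alpha>. homset \<Lambda> (\<s> \<beta>) (\<s> \<gamma>) \<noteq> {})"
    using FE[OF _ \<beta>] G(1) by (metis subsetD)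
  let ?H = "\<Union>\<alpha>\<in>G. \<Phi> \<alpha>"
  have "finite ?H" using G(2) \<Phi> unfolding FE_def by blast
  have Hm: "\<gamma> \<in> mor \<Lambda>" if \<gamma>: "\<gamma> \<in> ?H" for \<gamma>
  proof -
    obtain \<alpha> where "\<alpha> \<in> G" "\<gamma> \<in> \<Phi> \<alpha>" using \<gamma> by blast
    then have "\<gamma> \<in> right_ideal \<Lambda> (\<r> \<alpha>)" "\<r> \<alpha> \<in> mor \<Lambda>" using \<Phi> G(1) rng_mor unfolding FE_def by blast+
    then show ?thesis by (rule right_idealD)
  qed
  have "\<exists>\<delta>. \<delta> \<in> mor \<Lambda> \<and> \<r> \<delta> = \<s> \<beta> \<and> \<s> \<delta> = \<s> \<gamma>" if "\<gamma> \<in> ?H" for \<gamma>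
    using \<Phi> that unfolding homset_def by blast
  then obtain d where d: "\<And>\<gamma>. \<gamma> \<in> ?H \<Longrightarrow> d \<gamma> \<in> mor \<Lambda> \<and> \<r> (d \<gamma>) = \<s> \<beta> \<and> \<s> (d \<gamma>) = \<s> \<gamma>" by metis
  have bd: "\<beta> \<cdot> d \<gamma> \<in> mor \<Lambda>" "\<s> (\<beta> \<cdot> d \<gamma>) = \<s> \<gamma>" if "\<gamma> \<in> ?H" for \<gamma>
    using d[OF that] \<beta> by (simp_all add: cmp_mor src_cmp)
  \<comment> \<open>The map \<open>\<beta> \<cdot> d \<gamma> \<cdot> z \<mapsto> \<gamma> \<cdot>
    z\<close>, possible since \<open>d \<gamma>\<close> has the source of \<open>\<gamma>\<close>.
    Its domain lies in \<open>f\<close>, so conjugating \<open>f\<close> by it gives the identity on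
    the whole right ideal of \<open>\<gamma>\<close>.\<close>
  define s where "s \<gamma> = tau \<Lambda> \<gamma> \<odot> (tau \<Lambda> (\<beta> \<cdot> d \<gamma>))\<inverse>" for \<gamma>
  have sS: "s \<gamma> \<in> cat_semigroup \<Lambda>" if "\<gamma> \<in> ?H" for \<gamma>
    unfolding s_def using Hm[OF that] bd(1)[OF that] by (intro cat_semigroup.intros)
  have cover: "(w, w) \<in> s \<gamma> \<odot> f \<odot> (s \<gamma>)\<inverse>" if \<gamma>: "\<gamma> \<in> ?H" and w: "w \<in> right_ideal \<Lambda> \<gamma>" for \<gamma> w
  proof -
    obtain z where z: "w = \<gamma> \<cdot> z" "z \<in> mor \<Lambda>" "\<r> z = \<s> \<gamma>" using w by (rule right_idealE)
    let ?y = "\<beta> \<cdot> d \<gamma> \<cdot> z"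
    have "(?y, w) \<in> s \<gamma>" unfolding s_def
      using tau_iff[OF Hm[OF \<gamma>]] tau_iff[OF bd(1)[OF \<gamma>]] z bd(2)[OF \<gamma>] by auto
    moreover have "(\<beta> \<cdot> d \<gamma>, \<beta> \<cdot> d \<gamma>) \<in> f" using semigroup_right_closed[OF fS(1) \<beta>f] d[OF \<gamma>] by blast
    then have "(?y, ?y) \<in> f" using semigroup_right_closed[OF fS(1)] z bd(2)[OF \<gamma>] by simp
    ultimately show ?thesis by blast
  qed
  have "outer_cover (cat_semigroup \<Lambda>) e ((\<lambda>s. s \<odot> f \<odot> s\<inverse>) ` s ` ?H)"
    unfolding outer_cover_iff[OF e]
  proof (intro conjI ballI impI)
    show "(\<lambda>s. s \<odot> f \<odot> s\<inverse>) ` s ` ?H \<subseteq> idems (cat_semigroup \<Lambda>)"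
      using idems_conj[OF sS f(1)] by auto
    fix g assume g: "g \<in> idems (cat_semigroup \<Lambda>)" and "g \<noteq> {} \<and> g \<subseteq> e"
    then obtain x where xg: "(x, x) \<in> g" and "(x, x) \<in> e" using idems_iff by fastforce
    then obtain \<alpha> where \<alpha>: "\<alpha> \<in> G" "x \<in> right_ideal \<Lambda> \<alpha>" unfolding G(3) by auto
    \<comment> \<open>Exhaustiveness supplies a common extension \<open>w\<close> of
      \<open>x\<close> and some \<open>\<gamma>\<close>; right closure of \<open>g\<close> then puts
      \<open>w\<close> into \<open>g\<close>.\<close>
    then obtain \<gamma> w where \<gamma>: "\<gamma> \<in> \<Phi> \<alpha>" "w \<in> right_ideal \<Lambda> \<gamma>" "w \<in> right_ideal \<Lambda> x"
      using \<Phi>[OF \<alpha>(1)] unfolding FE_def meets_def by blast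
    have gS: "g \<in> cat_semigroup \<Lambda>" using g idems_iff by blast
    have "(w, w) \<in> g" using \<gamma>(3) semigroup_right_closed[OF gS xg] by (auto elim: right_idealE)
    moreover have \<gamma>H: "\<gamma> \<in> ?H" using \<gamma>(1) \<alpha>(1) by blast
    ultimately have "(s \<gamma> \<odot> f \<odot> (s \<gamma>)\<inverse>) \<inter> g \<noteq> {}" using cover[OF \<gamma>H \<gamma>(2)] by blast
    then show "\<exists>z\<in>(\<lambda>s. s \<odot> f \<odot> s\<inverse>) ` s ` ?H. z \<inter> g \<noteq> {}" using \<gamma>H by blast
  qed
  moreover have "s ` ?H \<subseteq> cat_semigroup \<Lambda>" using sS by blast
  ultimately show ?thesis using \<open>finite ?H\<close> by (meson finite_imageI)
qed

end

text \<open>Passes between indexed families and finite sets, using an enumeration of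
  \<open>F\<close> by \<open>{1..card F}\<close>; \<open>n = 0\<close> corresponds to the empty
  set.\<close>

lemma finite_family_iff:
  "(\<exists>(n::nat) s. (\<forall>i\<in>{1..n}. s i \<in> S) \<and> P ((\<lambda>i. g (s i)) ` {1..n})) \<longleftrightarrow>
    (\<exists>F\<subseteq>S. finite F \<and> P (g ` F))"
proof
  assume "\<exists>(n::nat) s. (\<forall>i\<in>{1..n}. s i \<in> S) \<and> P ((\<lambda>i. g (s i)) ` {1..n})"
  then obtain n s where s: "\<forall>i\<in>{1..n::nat}. s i \<in> S" "P ((\<lambda>i. g (s i)) ` {1..n})" by blast
  have "(\<lambda>i. g (s i)) ` {1..n} = g ` s ` {1..n}" by (simp add: image_image)
  with s show "\<exists>F\<subseteq>S. finite F \<and> P (g ` F)" by (intro exI[of _ "s ` {1..n}"]) auto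
next
  assume "\<exists>F\<subseteq>S. finite F \<and> P (g ` F)"
  then obtain F where F: "F \<subseteq> S" "finite F" "P (g ` F)" by blast
  obtain s where s: "bij_betw s {1..card F} F" using ex_bij_betw_nat_finite_1[OF F(2)] by blast
  then have img: "s ` {1..card F} = F" by (rule bij_betw_imp_surj_on)
  then have "(\<lambda>i. g (s i)) ` {1..card F} = g ` F" by (simp flip: image_image)
  moreover have "\<forall>i\<in>{1..card F}. s i \<in> S" using img F(1) by blast
  ultimately show "\<exists>(n::nat) s. (\<forall>i\<in>{1..n}. s i \<in> S) \<and> P ((\<lambda>i. g (s i)) ` {1..n})"
    using F(3) by metis
qed

theorem theorem6p6:
  fixes \<Lambda> :: "'a category"
  assumes "small_category \<Lambda>"
    and "countable (mor \<Lambda>)"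
    and "left_cancellative \<Lambda>"
    and "finitely_aligned \<Lambda>"
  shows
    "(minimal_groupoid (tight_groupoid (cat_semigroup \<Lambda>))
      \<longleftrightarrow>
      (\<forall>e\<in>idems (cat_semigroup \<Lambda>). \<forall>f\<in>idems (cat_semigroup \<Lambda>). e \<noteq> {} \<longrightarrow> f \<noteq> {} \<longrightarrow>
         (\<exists>(n::nat) s. (\<forall>i\<in>{1..n}. s i \<in> cat_semigroup \<Lambda>) \<and>
            outer_cover (cat_semigroup \<Lambda>) e ((\<lambda>i. s i \<odot> f \<odot> (s i)\<inverse>) ` {1..n}))))
     \<and>
     ((\<forall>e\<in>idems (cat_semigroup \<Lambda>). \<forall>f\<in>idems (cat_semigroup \<Lambda>). e \<noteq> {} \<longrightarrow> f \<noteq> {} \<longrightarrow>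
         (\<exists>(n::nat) s. (\<forall>i\<in>{1..n}. s i \<in> cat_semigroup \<Lambda>) \<and>
            outer_cover (cat_semigroup \<Lambda>) e ((\<lambda>i. s i \<odot> f \<odot> (s i)\<inverse>) ` {1..n})))
      \<longleftrightarrow>
      (\<forall>\<alpha>\<in>mor \<Lambda>. \<forall>\<beta>\<in>mor \<Lambda>. \<exists>F\<in>FE \<Lambda> \<alpha>. \<forall>\<gamma>\<in>F.
         homset \<Lambda> (src \<Lambda> \<beta>) (src \<Lambda> \<gamma>) \<noteq> {}))"
proof -
  interpret finitely_aligned_lcsc \<Lambda>
    using assms by (simp add: finitely_aligned_lcsc_def finitely_aligned_lcsc_axioms_def)
  let ?S = "cat_semigroup \<Lambda>"
  let ?minimal = "minimal_groupoid (tight_groupoid ?S)"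
  let ?covers = "\<forall>e\<in>idems ?S. \<forall>f\<in>idems ?S. e \<noteq> {} \<longrightarrow> f \<noteq> {} \<longrightarrow>
    (\<exists>F\<subseteq>?S. finite F \<and> outer_cover ?S e ((\<lambda>s. s \<odot> f \<odot> s\<inverse>) ` F))"
  let ?exhaustive = "\<forall>\<alpha>\<in>mor \<Lambda>. \<forall>\<beta>\<in>mor \<Lambda>. \<exists>F\<in>FE \<Lambda> \<alpha>. \<forall>\<gamma>\<in>F. homset \<Lambda> (\<s> \<beta>) (\<s> \<gamma>) \<noteq> {}"
  have "?minimal \<longleftrightarrow> ?covers"
  proof
    show "?covers" if ?minimal using minimal_imp_outer_cover[OF that] by simp
    show "?minimal" if ?covers by (rule outer_cover_imp_minimal) (use that in simp)
  qed
  moreover have "?covers \<longleftrightarrow> ?exhaustive"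
  proof
    assume covers: ?covers
    show ?exhaustive
    proof (intro ballI)
      fix \<alpha> \<beta> assume ab: "\<alpha> \<in> mor \<Lambda>" "\<beta> \<in> mor \<Lambda>"
      \<comment> \<open>The covering condition is applied to the identities on the right ideals of
        \<open>\<alpha>\<close> and \<open>\<beta>\<close>.\<close>
      obtain F where "F \<subseteq> ?S" "finite F" "outer_cover ?S (Id_on (right_ideal \<Lambda> \<alpha>))
          ((\<lambda>s. s \<odot> Id_on (right_ideal \<Lambda> \<beta>) \<odot> s\<inverse>) ` F)"
        using covers[THEN bspec, OF right_ideal_idem(1)[OF ab(1)], THEN bspec, OF right_ideal_idem(1)[OF ab(2)],
          THEN mp, OF right_ideal_idem(2)[OF ab(1)], THEN mp, OF right_ideal_idem(2)[OF ab(2)]]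
        by (elim exE conjE) (rule that)
      then show "\<exists>F\<in>FE \<Lambda> \<alpha>. \<forall>\<gamma>\<in>F. homset \<Lambda> (\<s> \<beta>) (\<s> \<gamma>) \<noteq> {}"
        by (rule outer_cover_imp_FE[OF ab])
    qed
  next
    assume ex: ?exhaustive
    show ?covers
    proof (intro ballI impI)
      fix e f assume ef: "e \<in> idems ?S" "f \<in> idems ?S" "f \<noteq> {}"
      show "\<exists>F\<subseteq>?S. finite F \<and> outer_cover ?S e ((\<lambda>s. s \<odot> f \<odot> s\<inverse>) ` F)"
        by (rule FE_imp_outer_cover[OF ef]) (use ex in simp)
    qed
  qed
  moreover have "(\<exists>(n::nat) s. (\<forall>i\<in>{1..n}. s i \<in> ?S) \<and>
        outer_cover ?S e ((\<lambda>i. s i \<odot> f \<odot> (s i)\<inverse>) ` {1..n})) \<longleftrightarrow>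
      (\<exists>F\<subseteq>?S. finite F \<and> outer_cover ?S e ((\<lambda>s. s \<odot> f \<odot> s\<inverse>) ` F))" for e f
    by (rule finite_family_iff[where g = "\<lambda>s. s \<odot> f \<odot> s\<inverse>" and P = "outer_cover ?S e"])
  ultimately show ?thesis by (simp only:)
qed

end
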